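(* Let $n$ be a positive integer. For every pair of random variables $\mathbf{A},\mathbf{B}$ taking values in $\mathbb{F}_2^n$, there exists a linear subspace $V\subseteq\mathbb{F}_2^n$ such that $$\mathrm{d}[\mathbf{A};\mathbf{U}_V]+\mathrm{d}[\mathbf{B};\mathbf{U}_V]\le 10\,\mathrm{d}[\mathbf{A};\mathbf{B}],$$ where $\mathbf{U}_V$ denotes a random variable uniformly distributed on $V$.
   Context: All logarithms are base $2$. For a random variable $\mathbf{X}$ on a finite set, its Shannon entropy is $\mathrm{H}(\mathbf{X})=\sum_{x\in\mathrm{Supp}(\mathbf{X})}-\Pr[\mathbf{X}=x]\log \Pr[\mathbf{X}=x]$. The entropic Ruzsa distance between random variables $\mathbf{X},\mathbf{Y}$ on $\mathbb{F}_2^n$ is $$\mathrm{d}[\mathbf{X};\mathbf{Y}]:=\mathrm{H}(\mathbf{X}'-\mathbf{Y}')-\tfrac12\left(\mathrm{H}(\mathbf{X})+\mathrm{H}(\mathbf{Y})\right),$$ where $\mathbf{X}',\mathbf{Y}'$ are independent copies of $\mathbf{X},\mathbf{Y}$ (i.e. $\mathbf{X}'$ has the distribution of $\mathbf{X}$, $\mathbf{Y}'$ has the distribution of $\mathbf{Y}$, and $\mathbf{X}',\mathbf{Y}'$ are independent). It depends only on the individual distributions of $\mathbf{X}$ and $\mathbf{Y}$, even if $\mathbf{X}$ and $\mathbf{Y}$ are correlated. *)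

theory Defs
  imports "HOL-Probability.Probability" "HOL-Library.Z2"
begin

instance bit :: finite
proof
  have "(UNIV :: bit set) = {0, 1}"
    by (auto intro: bit.exhaust)
  then show "finite (UNIV :: bit set)"
    by (metis finite.emptyI finite.insertI)
qed

text \<open>
  The base-2 Shannon entropy is the library's entropy relative to counting measure. For a random
  variable on a finite type it is the usual sum over the support, see the lemma below.
\<close>

definition shannon_entropy :: "'w measure \<Rightarrow> ('w \<Rightarrow> 'a) \<Rightarrow> real" where
  "shannon_entropy M X = prob_space.entropy M 2 (count_space UNIV) X"

lemma shannon_entropy_eq_sum:
  fixes X :: "'w \<Rightarrow> 'a::finite"
  assumes M: "prob_space M" and X: "X \<in> measurable M (count_space UNIV)"
  defines "p \<equiv> \<lambda>x. measure M (X -` {x} \<inter> space M)"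
  shows "shannon_entropy M X = (\<Sum>x\<in>{x. p x \<noteq> 0}. - p x * log 2 (p x))"
proof -
  interpret prob_space M by fact
  interpret information_space M 2 by standard simp
  have D: "distributed M (count_space UNIV) X (\<lambda>x. ennreal (p x))"
    unfolding distributed_def
  proof (intro conjI)
    show "distr M (count_space UNIV) X = density (count_space UNIV) (\<lambda>x. ennreal (p x))"
    proof (rule measure_eqI_finite[where A = UNIV])
      show "emeasure (distr M (count_space UNIV) X) {a}
          = emeasure (density (count_space UNIV) (\<lambda>x. ennreal (p x))) {a}" for a
        using X by (simp add: emeasure_distr emeasure_density p_def emeasure_eq_measure
            nn_integral_count_space_finite indicator_def if_distrib cong: if_cong)
    qed auto
  qed (use X in auto)
  have "shannon_entropy M X = - (\<Sum>x\<in>UNIV. p x * log 2 (p x))"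
    unfolding shannon_entropy_def
    by (subst entropy_distr[OF D]) (auto simp: p_def lebesgue_integral_count_space_finite)
  also have "\<dots> = (\<Sum>x\<in>UNIV. - p x * log 2 (p x))"
    by (simp add: sum_negf)
  also have "\<dots> = (\<Sum>x\<in>{x. p x \<noteq> 0}. - p x * log 2 (p x))"
    by (rule sum.mono_neutral_right) auto
  finally show ?thesis .
qed

text \<open>
  \<open>X\<close> and \<open>Y\<close> may live on different probability spaces. Their independent copies are the
  two coordinate pullbacks to the product space, so only the two marginal laws matter, even when
  \<open>M = N\<close> and \<open>X\<close>, \<open>Y\<close> are correlated.
\<close>

definition ruzsa_dist ::
    "'w measure \<Rightarrow> ('w \<Rightarrow> 'a::ab_group_add) \<Rightarrow> 'v measure \<Rightarrow> ('v \<Rightarrow> 'a) \<Rightarrow> real" where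
  "ruzsa_dist M X N Y =
     shannon_entropy (M \<Otimes>\<^sub>M N) (\<lambda>(w, v). X w - Y v)
       - (shannon_entropy M X + shannon_entropy N Y) / 2"

end

theory Submission
  imports Defs
begin

text \<open>
  Fix \<open>0 < \<eta> < 1 / 8\<close> and minimize \<open>d[X; Y] + \<eta> d[A; X] + \<eta> d[B; Y]\<close> over all pairs of laws,
  following Gowers, Green, Manners and Tao; the constant comes from Liao's variant of their endgame.
  Let \<open>X1\<close>, \<open>X2\<close> be minimizers and take two independent copies of each. The minimality is tested
  against sums of two of these variables, against one of them conditioned on such a sum, and
  against the conditionally independent copies of the entropic Balog--Szemeredi--Gowers lemma
  applied to the pairwise sums, conditioned on the total sum. Adding up the resulting linear
  inequalities between entropies gives \<open>k \<le> 8 \<eta> k\<close> for \<open>k = d[X1; X2]\<close>, hence \<open>k = 0\<close>. This makes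
  \<open>X1\<close> uniform on a coset of a subgroup \<open>V\<close>. Comparing the minimum with the value at \<open>(B, A)\<close> yields
  the bound with constant \<open>2 + 1 / \<eta>\<close>, and as there are finitely many subgroups, \<open>\<eta>\<close> can tend
  to \<open>1 / 8\<close>.
\<close>

section \<open>Finite abelian groups of exponent two\<close>

text \<open>The argument uses only this much of F_2^n: subtraction is addition, a subspace is a set
  containing 0 and closed under addition, and finiteness turns entropies into finite sums.\<close>

class char2_group = ab_group_add + finite +
  assumes add_self [simp]: "a + a = 0"
begin

lemma add_self_left [simp]: "a + (a + b) = b"
  by (simp flip: add.assoc)

lemma diff_eq_add [simp]: "a - b = a + b"
  by (metis add_self_left add_diff_cancel_left' add.commute)

end

instance bit :: char2_group
  by standard simp

instance vec :: (char2_group, finite) char2_group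
  by standard (simp add: vec_eq_iff)

subsection \<open>Entropy and submodularity\<close>

text \<open>Points of probability zero contribute 0 because of the first factor, so summing over the
  whole type gives the sum over the support.\<close>

definition ent :: "'a::finite pmf \<Rightarrow> real" where
  "ent p = (\<Sum>x\<in>UNIV. - pmf p x * log 2 (pmf p x))"

abbreviation H :: "'w pmf \<Rightarrow> ('w \<Rightarrow> 'a::finite) \<Rightarrow> real" where
  "H p X \<equiv> ent (map_pmf X p)"

lemma sum_pmf_UNIV [simp]: "(\<Sum>x\<in>UNIV. pmf p (x::'a::finite)) = 1"
  by (rule sum_pmf_eq_1) auto

lemma sum_pmf_map:
  fixes p :: "'w::finite pmf" and X :: "'w \<Rightarrow> 'a::finite"
  shows "(\<Sum>x\<in>UNIV. pmf (map_pmf X p) x * f x) = (\<Sum>w\<in>UNIV. pmf p w * f (X w))"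
proof -
  have "measure_pmf.expectation (map_pmf X p) f = measure_pmf.expectation p (\<lambda>w. f (X w))"
    by simp
  then show ?thesis
    by (simp add: integral_measure_pmf[of UNIV] del: integral_map_pmf)
qed

text \<open>Entropy as expected surprisal under the base law \<open>p\<close>, so that different
  variables can be compared point by point.\<close>

lemma H_eq:
  fixes p :: "'w::finite pmf"
  shows "H p X = (\<Sum>w\<in>UNIV. pmf p w * - log 2 (pmf (map_pmf X p) (X w)))"
  unfolding sum_pmf_map[of X p "\<lambda>x. - log 2 (pmf (map_pmf X p) x)", symmetric] ent_def by simp

text \<open>On the support each fibre of \<open>X\<close> lies in the fibre of \<open>Y\<close>
  through the same point, so \<open>Y\<close> has the larger mass and the smaller surprisal there.
  Phrasing the dependence by fibres avoids exhibiting a function.\<close>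

lemma H_mono:
  fixes p :: "'w::finite pmf"
  assumes "\<And>w w'. w \<in> set_pmf p \<Longrightarrow> w' \<in> set_pmf p \<Longrightarrow> X w = X w' \<Longrightarrow> Y w = Y w'"
  shows "H p Y \<le> H p X"
  unfolding H_eq
proof (rule sum_mono)
  fix w :: 'w
  show "pmf p w * - log 2 (pmf (map_pmf Y p) (Y w)) \<le> pmf p w * - log 2 (pmf (map_pmf X p) (X w))"
  proof (cases "w \<in> set_pmf p")
    case True
    have "pmf (map_pmf X p) (X w) \<le> pmf (map_pmf Y p) (Y w)"
      unfolding pmf_map
    proof (intro measure_pmf.finite_measure_mono_AE)
      show "AE w' in measure_pmf p. w' \<in> X -` {X w} \<longrightarrow> w' \<in> Y -` {Y w}"
        using assms[OF _ True] by (simp add: AE_measure_pmf_iff)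
    qed simp
    moreover have "0 < pmf (map_pmf X p) (X w)"
      using True by (simp add: pmf_positive_iff)
    ultimately show ?thesis
      by (intro mult_left_mono) auto
  qed (simp add: set_pmf_iff)
qed

lemma H_cong:
  fixes p :: "'w::finite pmf"
  assumes "\<And>w w'. w \<in> set_pmf p \<Longrightarrow> w' \<in> set_pmf p \<Longrightarrow> X w = X w' \<longleftrightarrow> Y w = Y w'"
  shows "H p X = H p Y"
  by (intro antisym H_mono) (auto simp: assms)

lemma H_le:
  fixes p :: "'w::finite pmf"
  assumes "\<And>w. w \<in> set_pmf p \<Longrightarrow> Y w = f (X w)"
  shows "H p Y \<le> H p X"
  by (rule H_mono) (metis assms)

lemma H_eqI:
  fixes p :: "'w::finite pmf"
  assumes "\<And>w. w \<in> set_pmf p \<Longrightarrow> Y w = f (X w)" "\<And>w. w \<in> set_pmf p \<Longrightarrow> X w = g (Y w)"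
  shows "H p X = H p Y"
  using H_le[of p Y f X] H_le[of p X g Y] assms by (blast intro: antisym)

text \<open>This is \<open>ln u \<le> u - 1\<close> at \<open>u = q / p\<close>, which is strict
  unless \<open>u = 1\<close>.\<close>

lemma gibbs_term:
  fixes p q :: real
  assumes "0 \<le> p" "0 \<le> q" "p > 0 \<Longrightarrow> q > 0"
  shows "p * (ln q - ln p) \<le> q - p" "p * (ln q - ln p) = q - p \<Longrightarrow> p = q"
proof -
  have *: "p * (ln q - ln p) \<le> q - p \<and> (p * (ln q - ln p) = q - p \<longrightarrow> p = q)"
  proof (cases "p = 0")
    case False
    with assms have pq: "p > 0" "q > 0" by auto
    then have l: "ln q - ln p = ln (q / p)" by (simp add: ln_div)
    have "ln (q / p) \<le> q / p - 1" using pq by (intro ln_le_minus_one) simp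
    then have "p * ln (q / p) \<le> p * (q / p - 1)" using pq by (intro mult_left_mono) auto
    moreover have e: "p * (q / p - 1) = q - p" using pq by (simp add: field_simps)
    moreover have "p = q" if "p * ln (q / p) = q - p"
    proof -
      have "ln (q / p) = q / p - 1" using that e pq by (metis mult_cancel_left less_irrefl)
      then have "q / p = 1" using pq by (intro ln_eq_minus_one) auto
      then show ?thesis using pq by simp
    qed
    ultimately show ?thesis by (simp add: l)
  qed (use assms in auto)
  then show "p * (ln q - ln p) \<le> q - p" "p * (ln q - ln p) = q - p \<Longrightarrow> p = q" by auto
qed

text \<open>Nonnegativity of relative entropy, by summing \<open>gibbs_term\<close>. The equality
  case later turns additivity of entropy into independence.\<close>

lemma gibbs:
  fixes p :: "'a::finite pmf" and q :: "'a \<Rightarrow> real"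
  assumes q: "\<And>x. 0 \<le> q x" "\<And>x. x \<in> set_pmf p \<Longrightarrow> q x > 0" "(\<Sum>x\<in>UNIV. q x) \<le> 1"
  shows "ent p \<le> (\<Sum>x\<in>UNIV. pmf p x * - log 2 (q x))"
    and "ent p = (\<Sum>x\<in>UNIV. pmf p x * - log 2 (q x)) \<Longrightarrow> pmf p x = q x"
proof -
  let ?t = "\<lambda>x. q x - pmf p x - pmf p x * (ln (q x) - ln (pmf p x))"
  have pos: "pmf p x > 0 \<Longrightarrow> q x > 0" for x
    using q(2) by (simp add: pmf_positive_iff)
  have t: "?t x \<ge> 0" for x using gibbs_term(1)[OF pmf_nonneg q(1) pos] by (simp add: algebra_simps)
  have d: "(\<Sum>x\<in>UNIV. pmf p x * - log 2 (q x)) - ent p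
      = - (\<Sum>x\<in>UNIV. pmf p x * (ln (q x) - ln (pmf p x))) / ln 2"
    unfolding ent_def by (simp add: log_def sum_subtractf[symmetric] sum_negf[symmetric]
        sum_divide_distrib) (auto intro!: sum.cong simp: field_simps)
  have s: "(\<Sum>x\<in>UNIV. ?t x) = (\<Sum>x\<in>UNIV. q x) - 1 - (\<Sum>x\<in>UNIV. pmf p x * (ln (q x) - ln (pmf p x)))"
    by (simp add: sum_subtractf)
  have "0 \<le> (\<Sum>x\<in>UNIV. ?t x)" using t by (intro sum_nonneg) auto
  then have "0 \<le> - (\<Sum>x\<in>UNIV. pmf p x * (ln (q x) - ln (pmf p x))) / ln 2"
    using s q(3) by (intro divide_nonneg_pos) auto
  then show "ent p \<le> (\<Sum>x\<in>UNIV. pmf p x * - log 2 (q x))" using d by linarith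
  assume "ent p = (\<Sum>x\<in>UNIV. pmf p x * - log 2 (q x))"
  then have "(\<Sum>x\<in>UNIV. pmf p x * (ln (q x) - ln (pmf p x))) = 0" using d by simp
  then have "(\<Sum>x\<in>UNIV. ?t x) = 0" using s q(3) \<open>0 \<le> (\<Sum>x\<in>UNIV. ?t x)\<close> by linarith
  then have "?t x = 0" using t by (simp add: sum_nonneg_eq_0_iff)
  then show "pmf p x = q x" using gibbs_term(2)[OF pmf_nonneg[of p x] q(1)[of x] pos] by simp
qed

lemma sum_pmf_pair1:
  fixes p :: "'w::finite pmf" and X :: "'w \<Rightarrow> 'a::finite" and Z :: "'w \<Rightarrow> 'c::finite"
  shows "(\<Sum>x\<in>UNIV. pmf (map_pmf (\<lambda>w. (X w, Z w)) p) (x, z)) = pmf (map_pmf Z p) z"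
proof -
  have "(\<Sum>x\<in>UNIV. pmf (map_pmf (\<lambda>w. (X w, Z w)) p) (x, z))
     = (\<Sum>x\<in>UNIV. measure p ((\<lambda>w. (X w, Z w)) -` {(x, z)}))"
    by (simp add: pmf_map)
  also have "\<dots> = measure p (\<Union>x. (\<lambda>w. (X w, Z w)) -` {(x, z)})"
    by (subst measure_pmf.finite_measure_finite_Union) (auto simp: disjoint_family_on_def)
  also have "(\<Union>x. (\<lambda>w. (X w, Z w)) -` {(x, z)}) = Z -` {z}" by auto
  finally show ?thesis by (simp add: pmf_map)
qed

text \<open>Nonnegativity of conditional mutual information: Gibbs compares the law of
  \<open>(X, Y, Z)\<close> with the law \<open>q\<close> that keeps the marginals of
  \<open>(X, Z)\<close> and \<open>(Y, Z)\<close> but makes \<open>X\<close> and \<open>Y\<close>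
  independent given \<open>Z\<close>.\<close>

lemma H_submod:
  fixes p :: "'w::finite pmf" and X :: "'w \<Rightarrow> 'a::finite" and Y :: "'w \<Rightarrow> 'b::finite"
    and Z :: "'w \<Rightarrow> 'c::finite"
  shows "H p (\<lambda>w. (X w, Y w, Z w)) + H p Z \<le> H p (\<lambda>w. (X w, Z w)) + H p (\<lambda>w. (Y w, Z w))"
proof -
  define P where "P = map_pmf (\<lambda>w. (X w, Y w, Z w)) p"
  define px where "px = map_pmf (\<lambda>w. (X w, Z w)) p"
  define py where "py = map_pmf (\<lambda>w. (Y w, Z w)) p"
  define pz where "pz = map_pmf Z p"
  define q where "q = (\<lambda>(x, y, z). pmf px (x, z) * pmf py (y, z) / pmf pz z)"
  have supp: "pmf px (x, z) > 0 \<and> pmf py (y, z) > 0 \<and> pmf pz z > 0" if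
      "(x, y, z) \<in> set_pmf P" for x y z
    using that by (auto simp: P_def px_def py_def pz_def pmf_positive_iff)
  have "(\<Sum>t\<in>UNIV. q t) = (\<Sum>x\<in>UNIV. \<Sum>y\<in>UNIV. \<Sum>z\<in>UNIV. pmf px (x, z) * pmf py (y, z) / pmf pz z)"
    by (simp add: q_def sum.cartesian_product UNIV_Times_UNIV[symmetric] del: UNIV_Times_UNIV)
  also have "\<dots> = (\<Sum>z\<in>UNIV. \<Sum>x\<in>UNIV. \<Sum>y\<in>UNIV. pmf px (x, z) * pmf py (y, z) / pmf pz z)"
    by (subst (2) sum.swap, subst sum.swap) (auto intro!: sum.cong intro: sum.swap)
  also have "\<dots> = (\<Sum>z\<in>UNIV. (\<Sum>x\<in>UNIV. pmf px (x, z)) * (\<Sum>y\<in>UNIV. pmf py (y, z)) / pmf pz z)"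
    by (simp add: sum_product sum_divide_distrib)
  also have "\<dots> = (\<Sum>z\<in>UNIV. pmf pz z)"
    unfolding px_def py_def sum_pmf_pair1 pz_def by (intro sum.cong) auto
  finally have q1: "(\<Sum>t\<in>UNIV. q t) = 1" by simp
  have "ent P \<le> (\<Sum>t\<in>UNIV. pmf P t * - log 2 (q t))"
    by (rule gibbs) (auto simp: q1, auto simp: q_def supp)
  also have "\<dots> = (\<Sum>t\<in>UNIV. pmf P t * (- log 2 (pmf px (fst t, snd (snd t))))
       + pmf P t * (- log 2 (pmf py (snd t))) - pmf P t * (- log 2 (pmf pz (snd (snd t)))))"
  proof (rule sum.cong)
    fix t :: "'a \<times> 'b \<times> 'c"
    obtain x y z where t: "t = (x, y, z)" by (cases t) auto
    show "pmf P t * - log 2 (q t) = pmf P t * (- log 2 (pmf px (fst t, snd (snd t))))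
       + pmf P t * (- log 2 (pmf py (snd t))) - pmf P t * (- log 2 (pmf pz (snd (snd t))))"
    proof (cases "t \<in> set_pmf P")
      case True
      then have "log 2 (q t) = log 2 (pmf px (x, z)) + log 2 (pmf py (y, z)) - log 2 (pmf pz z)"
        using supp[of x y z] by (simp add: t q_def log_divide log_mult)
      then show ?thesis by (simp only: t fst_conv snd_conv) (simp add: ring_distribs)
    qed (simp add: set_pmf_iff)
  qed simp
  also have "\<dots> = ent px + ent py - ent pz"
  proof -
    have "px = map_pmf (\<lambda>t. (fst t, snd (snd t))) P" "py = map_pmf snd P"
        "pz = map_pmf (\<lambda>t. snd (snd t)) P"
      by (simp_all add: P_def px_def py_def pz_def map_pmf_comp)
    then show ?thesis by (simp add: sum.distrib sum_subtractf sum_negf H_eq)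
  qed
  finally show ?thesis by (simp add: P_def px_def py_def pz_def)
qed

lemma ent_return [simp]: "ent (return_pmf c) = 0"
  by (auto simp: ent_def intro!: sum.neutral simp: indicator_def)

lemma H_subadd:
  fixes p :: "'w::finite pmf"
  shows "H p (\<lambda>w. (X w, Y w)) \<le> H p X + H p Y"
proof -
  have "H p (\<lambda>w. (X w, Y w)) = H p (\<lambda>w. (X w, Y w, ()))"
    "H p X = H p (\<lambda>w. (X w, ()))" "H p Y = H p (\<lambda>w. (Y w, ()))"
    by (rule H_cong; simp)+
  then show ?thesis using H_submod[where p=p and X=X and Y=Y and Z="\<lambda>_. ()"] by simp
qed

lemma ent_pair: "ent (pair_pmf p q) = ent p + ent (q :: 'b::finite pmf)" for p :: "'a::finite pmf"
proof -
  have "ent (pair_pmf p q) = (\<Sum>x\<in>UNIV. \<Sum>y\<in>UNIV. - (pmf p x * pmf q y) * log 2 (pmf p x * pmf q y))"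
    by (auto simp: ent_def sum.cartesian_product pmf_pair intro!: sum.cong)
  also have "\<dots> = (\<Sum>x\<in>UNIV. \<Sum>y\<in>UNIV. pmf q y * (- pmf p x * log 2 (pmf p x)) + pmf p x *
      (- pmf q y * log 2 (pmf q y)))"
  proof (intro sum.cong refl)
    fix x y show "- (pmf p x * pmf q y) * log 2 (pmf p x * pmf q y) = pmf q y *
        (- pmf p x * log 2 (pmf p x)) + pmf p x * (- pmf q y * log 2 (pmf q y))"
      by (cases "pmf p x = 0"; cases "pmf q y = 0") (auto simp: log_mult algebra_simps)
  qed
  also have "\<dots> = ent p + ent q"
    by (simp only: sum.distrib ent_def sum_distrib_right[symmetric]
        sum_distrib_left[symmetric] sum_pmf_UNIV mult_1)
  finally show ?thesis .
qed

subsection \<open>Conditioning\<close>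

text \<open>A disintegration: \<open>r\<close> is the law of the condition and \<open>k c\<close>
  the conditional law above \<open>c\<close>.\<close>

definition joint :: "'c pmf \<Rightarrow> ('c \<Rightarrow> 'a pmf) \<Rightarrow> ('a \<times> 'c) pmf" where
  "joint r k = bind_pmf r (\<lambda>c. map_pmf (\<lambda>x. (x, c)) (k c))"

lemma pmf_joint: "pmf (joint r k) (x, c) = pmf r c * pmf (k c) x" for c :: "'c::finite"
proof -
  have *: "pmf (map_pmf (\<lambda>x. (x, c')) (k c')) (x, c) = (if c' = c then pmf (k c) x else 0)" for c'
  proof (cases "c' = c")
    case True
    have "inj (\<lambda>x. (x, c))" by (auto simp: inj_def)
    from pmf_map_inj'[OF this, of "k c" x] True show ?thesis by simp
  qed (auto intro!: pmf_map_outside)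
  show ?thesis
    unfolding joint_def by (simp add: pmf_bind *
        integral_measure_pmf[of UNIV] if_distrib cong: if_cong)
qed

lemma joint_cond_pmf:
  fixes p :: "'w::finite pmf" and C :: "'w \<Rightarrow> 'c::finite"
  shows "map_pmf (\<lambda>w. (w, C w)) p = joint (map_pmf C p) (\<lambda>c. cond_pmf p (C -` {c}))"
proof (rule pmf_eqI, clarify)
  fix w c
  show "pmf (map_pmf (\<lambda>w. (w, C w)) p) (w, c) = pmf
      (joint (map_pmf C p) (\<lambda>c. cond_pmf p (C -` {c}))) (w, c)"
  proof (cases "C w = c \<and> w \<in> set_pmf p")
    case True
    have "inj (\<lambda>w. (w, C w))" by (auto simp: inj_def)
    from pmf_map_inj'[OF this, of p w] have "pmf (map_pmf (\<lambda>w. (w, C w)) p) (w, c) = pmf p w"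
      using True by simp
    moreover have ne: "set_pmf p \<inter> C -` {c} \<noteq> {}" using True by auto
    moreover have "measure p (C -` {c}) \<noteq> 0"
      using ne by (simp add: measure_measure_pmf_not_zero)
    ultimately show ?thesis using True by (simp add: pmf_joint pmf_cond[OF ne] pmf_map)
  next
    case False
    then have "pmf (map_pmf (\<lambda>w. (w, C w)) p) (w, c) = 0"
      by (intro pmf_map_outside) auto
    moreover have "pmf (joint (map_pmf C p) (\<lambda>c. cond_pmf p (C -` {c}))) (w, c) = 0"
    proof (cases "c \<in> C ` set_pmf p")
      case True
      then have ne: "set_pmf p \<inter> C -` {c} \<noteq> {}" by auto
      show ?thesis using False by (auto simp: pmf_joint pmf_cond[OF ne] set_pmf_iff)
    next
      \<comment> \<open>Here \<open>cond_pmf\<close> conditions on a null event and is unspecified,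
        but its weight is zero.\<close>
      case F: False
      then have "pmf (map_pmf C p) c = 0" by (simp add: pmf_map_outside)
      then show ?thesis by (simp add: pmf_joint)
    qed
    ultimately show ?thesis by simp
  qed
qed

lemma map_joint: "map_pmf (\<lambda>(x, c). (f c x, c)) (joint r k) = joint r (\<lambda>c. map_pmf (f c) (k c))"
  by (simp add: joint_def map_bind_pmf map_pmf_comp)

lemma map_snd_joint [simp]: "map_pmf snd (joint r k) = r"
  by (simp add: joint_def map_bind_pmf map_pmf_comp map_pmf_const bind_return_pmf')

text \<open>Chain rule: the logarithm of the product of masses splits, and the factor it does not
  involve sums to 1.\<close>

lemma ent_joint:
  fixes r :: "'c::finite pmf" and k :: "'c \<Rightarrow> 'a::finite pmf"
  shows "ent (joint r k) = ent r + (\<Sum>c\<in>UNIV. pmf r c * ent (k c))"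
proof -
  have "ent (joint r k) = (\<Sum>x\<in>UNIV. \<Sum>c\<in>UNIV. - (pmf r c * pmf (k c) x) * log 2
      (pmf r c * pmf (k c) x))"
    by (auto simp: ent_def sum.cartesian_product pmf_joint intro!: sum.cong)
  also have "\<dots> = (\<Sum>c\<in>UNIV. \<Sum>x\<in>UNIV. - (pmf r c * pmf (k c) x) * log 2 (pmf r c * pmf (k c) x))"
    by (rule sum.swap)
  also have "\<dots> = (\<Sum>c\<in>UNIV. \<Sum>x\<in>UNIV. pmf (k c) x * (- pmf r c * log 2 (pmf r c)) + pmf r c *
      (- pmf (k c) x * log 2 (pmf (k c) x)))"
  proof (intro sum.cong refl)
    fix x c show "- (pmf r c * pmf (k c) x) * log 2 (pmf r c * pmf (k c) x) = pmf (k c) x *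
        (- pmf r c * log 2 (pmf r c)) + pmf r c * (- pmf (k c) x * log 2 (pmf (k c) x))"
      by (cases "pmf r c = 0"; cases "pmf (k c) x = 0") (auto simp: log_mult algebra_simps)
  qed
  also have "\<dots> = ent r + (\<Sum>c\<in>UNIV. pmf r c * ent (k c))"
    by (simp only: sum.distrib ent_def sum_distrib_right[symmetric]
        sum_distrib_left[symmetric] sum_pmf_UNIV mult_1)
  finally show ?thesis .
qed

text \<open>Independence is witnessed by the conditional laws themselves, since minimality is going
  to be tested on \<open>kx c\<close> and \<open>ky c\<close> for each \<open>c\<close>.\<close>

definition cond_indep :: "'w pmf \<Rightarrow> ('w \<Rightarrow> 'a) \<Rightarrow> ('w \<Rightarrow> 'b) \<Rightarrow> ('w \<Rightarrow> 'c) \<Rightarrow> bool" where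
  "cond_indep p X Y C \<longleftrightarrow> (\<exists>kx ky. map_pmf (\<lambda>w. ((X w, Y w), C w)) p
     = joint (map_pmf C p) (\<lambda>c. pair_pmf (kx c) (ky c)))"

lemma cond_indepE:
  assumes "cond_indep p X Y C"
  obtains kx ky where
    "map_pmf (\<lambda>w. ((X w, Y w), C w)) p = joint (map_pmf C p) (\<lambda>c. pair_pmf (kx c) (ky c))"
    "map_pmf (\<lambda>w. (X w, C w)) p = joint (map_pmf C p) kx"
    "map_pmf (\<lambda>w. (Y w, C w)) p = joint (map_pmf C p) ky"
proof -
  obtain kx ky where *: "map_pmf (\<lambda>w. ((X w, Y w), C w)) p
     = joint (map_pmf C p) (\<lambda>c. pair_pmf (kx c) (ky c))"
    using assms by (auto simp: cond_indep_def)
  have f1: "map_pmf (\<lambda>w. (X w, C w)) p = joint (map_pmf C p) kx"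
    using arg_cong[OF *, of "map_pmf (\<lambda>(x, c). (fst x, c))"]
    by (simp add: map_joint map_pmf_comp map_fst_pair_pmf)
  have f2: "map_pmf (\<lambda>w. (Y w, C w)) p = joint (map_pmf C p) ky"
    using arg_cong[OF *, of "map_pmf (\<lambda>(x, c). (snd x, c))"]
    by (simp add: map_joint map_pmf_comp map_snd_pair_pmf)
  show ?thesis by (rule that[OF * f1 f2])
qed

lemma cond_indep_H:
  fixes p :: "'w::finite pmf" and C :: "'w \<Rightarrow> 'c::finite"
    and X :: "'w \<Rightarrow> 'a::finite" and Y :: "'w \<Rightarrow> 'b::finite"
  assumes "cond_indep p X Y C"
  shows "H p (\<lambda>w. (X w, Y w, C w)) + H p C = H p (\<lambda>w. (X w, C w)) + H p (\<lambda>w. (Y w, C w))"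
proof -
  obtain kx ky where *: "map_pmf (\<lambda>w. ((X w, Y w), C w)) p
     = joint (map_pmf C p) (\<lambda>c. pair_pmf (kx c) (ky c))"
    "map_pmf (\<lambda>w. (X w, C w)) p = joint (map_pmf C p) kx"
    "map_pmf (\<lambda>w. (Y w, C w)) p = joint (map_pmf C p) ky"
    by (rule cond_indepE[OF assms])
  have "H p (\<lambda>w. (X w, Y w, C w)) = H p (\<lambda>w. ((X w, Y w), C w))"
    by (rule H_cong) auto
  then show ?thesis
    by (simp add: * ent_joint ent_pair algebra_simps sum.distrib)
qed

text \<open>Above \<open>(c, d)\<close> the conditional law of a product law is the product of the
  two conditional laws; \<open>?g\<close> only regroups coordinates.\<close>

lemma cond_indep_pair:
  fixes p :: "'w::finite pmf" and q :: "'v::finite pmf" and C :: "'w \<Rightarrow> 'c::finite" and D ::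
      "'v \<Rightarrow> 'd::finite"
  shows "cond_indep (pair_pmf p q) (\<lambda>(w, v). X w) (\<lambda>(w, v). Y v) (\<lambda>(w, v). (C w, D v))"
proof -
  let ?kx = "\<lambda>c. map_pmf X (cond_pmf p (C -` {c}))" and ?ky
      = "\<lambda>d. map_pmf Y (cond_pmf q (D -` {d}))"
  have X: "map_pmf (\<lambda>w. (X w, C w)) p = joint (map_pmf C p) ?kx"
    using arg_cong[OF joint_cond_pmf[of C p], of "map_pmf (\<lambda>(w, c). (X w, c))"]
    by (simp add: map_joint map_pmf_comp)
  have Y: "map_pmf (\<lambda>w. (Y w, D w)) q = joint (map_pmf D q) ?ky"
    using arg_cong[OF joint_cond_pmf[of D q], of "map_pmf (\<lambda>(w, c). (Y w, c))"]
    by (simp add: map_joint map_pmf_comp)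
  have C: "map_pmf (\<lambda>(w, v). (C w, D v)) (pair_pmf p q) = pair_pmf (map_pmf C p) (map_pmf D q)"
    by (rule map_pair)
  let ?g = "\<lambda>((x, c), (y, d)). ((x, y), (c, d))"
  have inj: "inj ?g" by (auto simp: inj_def)
  have "map_pmf (\<lambda>w. ((case_prod (\<lambda>w v. X w) w, case_prod (\<lambda>w v. Y v) w), case_prod
      (\<lambda>w v. (C w, D v)) w)) (pair_pmf p q)
      = map_pmf ?g (map_pmf (\<lambda>(w, v). ((X w, C w), (Y v, D v))) (pair_pmf p q))"
    by (simp add: map_pmf_comp split_def)
  also have "\<dots> = map_pmf ?g (pair_pmf (joint (map_pmf C p) ?kx) (joint (map_pmf D q) ?ky))"
    by (simp add: map_pair X Y)
  also have "\<dots> = joint (pair_pmf (map_pmf C p) (map_pmf D q))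
      (\<lambda>c. pair_pmf (?kx (fst c)) (?ky (snd c)))"
  proof (rule pmf_eqI, clarify)
    fix x y c d
    have "pmf (map_pmf ?g (pair_pmf (joint (map_pmf C p) ?kx) (joint (map_pmf D q) ?ky)))
        ((x, y), (c, d))
        = pmf (pair_pmf (joint (map_pmf C p) ?kx) (joint (map_pmf D q) ?ky)) ((x, c), (y, d))"
      using pmf_map_inj'[OF inj, of _ "((x, c), (y, d))"] by simp
    then show "pmf (map_pmf ?g (pair_pmf (joint (map_pmf C p) ?kx) (joint (map_pmf D q) ?ky)))
        ((x, y), (c, d))
        = pmf (joint (pair_pmf (map_pmf C p) (map_pmf D q))
            (\<lambda>c. pair_pmf (?kx (fst c)) (?ky (snd c)))) ((x, y), (c, d))"
      by (simp add: pmf_pair pmf_joint)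
  qed
  finally show ?thesis
    unfolding cond_indep_def C by (intro exI[of _ "\<lambda>c. ?kx (fst c)"] exI[of _ "\<lambda>c. ?ky (snd c)"])
qed

subsection \<open>Ruzsa distance\<close>

definition conv :: "'a::plus pmf \<Rightarrow> 'a pmf \<Rightarrow> 'a pmf" where
  "conv x y = map_pmf (\<lambda>(a, b). a + b) (pair_pmf x y)"

text \<open>In exponent two the law of the independent difference is \<open>conv\<close>.\<close>

definition rdist :: "'a::char2_group pmf \<Rightarrow> 'a pmf \<Rightarrow> real" where
  "rdist x y = ent (conv x y) - (ent x + ent y) / 2"

text \<open>Ruzsa distance with only the second variable conditioned,
  \<open>H(u + X | C) - (H(u) + H(X | C)) / 2\<close> for \<open>u\<close> of law \<open>y\<close>,
  each conditional entropy being a joint entropy minus that of \<open>C\<close>.\<close>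

definition cdist :: "'a::char2_group pmf \<Rightarrow> 'w pmf \<Rightarrow> ('w \<Rightarrow> 'a) \<Rightarrow> ('w \<Rightarrow> 'c::finite) \<Rightarrow> real" where
  "cdist y p X C = H (pair_pmf y p) (\<lambda>(u, w). (u + X w, C w))
     - (ent y + H p (\<lambda>w. (X w, C w)) + H p C) / 2"

lemma pair_bind: "pair_pmf y (bind_pmf r f) = bind_pmf r (\<lambda>c. pair_pmf y (f c))"
  unfolding pair_pmf_def bind_assoc_pmf by (rule bind_commute_pmf)

text \<open>By the chain rule the entropy expression is the mean distance from \<open>y\<close> to
  the conditional laws; in this form it enters the penalty terms.\<close>

lemma cdist_joint:
  assumes "map_pmf (\<lambda>w. (X w, C w)) p = joint r k"
  shows "cdist y p X C = (\<Sum>c\<in>UNIV. pmf r c * rdist y (k c))"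
proof -
  have r: "map_pmf C p = r"
    using arg_cong[OF assms, of "map_pmf snd"] by (simp add: map_pmf_comp)
  have "map_pmf (\<lambda>(u, w). (u + X w, C w)) (pair_pmf y p)
      = map_pmf (\<lambda>(u, (x, c)). (u + x, c)) (pair_pmf y (map_pmf (\<lambda>w. (X w, C w)) p))"
    by (simp add: pair_map_pmf2 map_pmf_comp split_def)
  also have "\<dots> = joint r (\<lambda>c. conv y (k c))"
    unfolding assms unfolding joint_def conv_def
    by (simp add: pair_bind map_bind_pmf pair_map_pmf2 map_pmf_comp split_def)
  finally have "cdist y p X C = (\<Sum>c\<in>UNIV. pmf r c * ent (conv y (k c)))
      - (ent y + (\<Sum>c\<in>UNIV. pmf r c * ent (k c))) / 2"
    unfolding cdist_def r assms by (simp add: ent_joint field_simps)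
  moreover have "(\<Sum>c\<in>UNIV. pmf r c * rdist y (k c))
     = (\<Sum>c\<in>UNIV. pmf r c * ent (conv y (k c)) - (pmf r c * ent y + pmf r c * ent (k c)) / 2)"
    by (intro sum.cong) (auto simp: rdist_def algebra_simps)
  ultimately show ?thesis
    by (simp only: sum_subtractf sum.distrib sum_divide_distrib[symmetric]
        sum_distrib_right[symmetric]
        sum_pmf_UNIV mult_1)
qed

text \<open>The entropy of \<open>C\<close> is subtracted once from the first term and twice, with
  weight one half, from the others, so it cancels.\<close>

lemma cond_rdist:
  fixes C :: "'w::finite \<Rightarrow> 'c::finite"
  assumes "map_pmf (\<lambda>w. (X w, C w)) p = joint (map_pmf C p) kx"
    "map_pmf (\<lambda>w. (Y w, C w)) p = joint (map_pmf C p) ky"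
    "map_pmf (\<lambda>w. (X w + Y w, C w)) p = joint (map_pmf C p) (\<lambda>c. conv (kx c) (ky c))"
  shows "(\<Sum>c\<in>UNIV. pmf (map_pmf C p) c * rdist (kx c) (ky c))
    = H p (\<lambda>w. (X w + Y w, C w)) - (H p (\<lambda>w. (X w, C w)) + H p (\<lambda>w. (Y w, C w))) / 2"
proof -
  let ?r = "map_pmf C p"
  have "(\<Sum>c\<in>UNIV. pmf ?r c * rdist (kx c) (ky c))
     = (\<Sum>c\<in>UNIV. pmf ?r c * ent
         (conv (kx c) (ky c)) - (pmf ?r c * ent (kx c) + pmf ?r c * ent (ky c)) / 2)"
    by (intro sum.cong) (auto simp: rdist_def algebra_simps)
  then show ?thesis
    unfolding assms ent_joint by (simp only: sum_subtractf sum.distrib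
        sum_divide_distrib[symmetric]) (simp add: field_simps)
qed

text \<open>Minimality is applied to the conditional laws above each \<open>c\<close> and averaged.
  With \<open>d1\<close>, \<open>d2\<close> the distances at the minimizers, the penalties are
  increments.\<close>

lemma rdist_minimal_cond:
  fixes C :: "'w::finite \<Rightarrow> 'c::finite"
  assumes min: "\<And>x y. k \<le> rdist x y + \<eta> * (rdist x0 x - d1) + \<eta> * (rdist y0 y - d2)"
    and indep: "cond_indep p X Y C"
  shows "k \<le> H p (\<lambda>w. (X w + Y w, C w)) - (H p (\<lambda>w. (X w, C w)) + H p (\<lambda>w. (Y w, C w))) / 2
    + \<eta> * (cdist x0 p X C - d1) + \<eta> * (cdist y0 p Y C - d2)"
proof -
  let ?r = "map_pmf C p"
  obtain kx ky where k: "map_pmf (\<lambda>w. ((X w, Y w), C w)) p = joint ?r (\<lambda>c. pair_pmf (kx c) (ky c))"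
    "map_pmf (\<lambda>w. (X w, C w)) p = joint ?r kx" "map_pmf (\<lambda>w. (Y w, C w)) p = joint ?r ky"
    by (rule cond_indepE[OF indep])
  have "map_pmf (\<lambda>w. (X w + Y w, C w)) p = joint ?r (\<lambda>c. conv (kx c) (ky c))"
    using arg_cong[OF k(1), of "map_pmf (\<lambda>(x, c). (case x of (a, b) \<Rightarrow> a + b, c))"]
    by (simp add: map_joint map_pmf_comp conv_def)
  note * = k(2,3) this
  have "k = (\<Sum>c\<in>UNIV. pmf ?r c * k)"
    by (simp add: sum_distrib_right[symmetric])
  also have "\<dots> \<le> (\<Sum>c\<in>UNIV. pmf ?r c *
      (rdist (kx c) (ky c) + \<eta> * (rdist x0 (kx c) - d1) + \<eta> * (rdist y0 (ky c) - d2)))"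
    by (intro sum_mono mult_left_mono min) auto
  also have "\<dots> = (\<Sum>c\<in>UNIV. pmf ?r c * rdist (kx c) (ky c))
     + \<eta> * ((\<Sum>c\<in>UNIV. pmf ?r c * rdist x0 (kx c)) - d1)
     + \<eta> * ((\<Sum>c\<in>UNIV. pmf ?r c * rdist y0 (ky c)) - d2)"
  proof -
    have e: "(\<Sum>c\<in>UNIV. pmf ?r c * (a c - b)) = (\<Sum>c\<in>UNIV. pmf ?r c * a c) - b" for a b
      by (simp add: right_diff_distrib sum_subtractf sum_distrib_right[symmetric])
    have "(\<Sum>c\<in>UNIV. pmf ?r c * (rdist (kx c) (ky c) + \<eta> * (rdist x0 (kx c) - d1) + \<eta> *
        (rdist y0 (ky c) - d2)))
      = (\<Sum>c\<in>UNIV. pmf ?r c * rdist (kx c) (ky c) + \<eta> * (pmf ?r c * (rdist x0 (kx c) - d1)) + \<eta> *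
          (pmf ?r c * (rdist y0 (ky c) - d2)))"
      by (intro sum.cong) (auto simp: algebra_simps)
    then show ?thesis by (simp only: sum.distrib sum_distrib_left[symmetric] e)
  qed
  finally show ?thesis
    unfolding cond_rdist[OF *] cdist_joint[OF *(1)] cdist_joint[OF *(2)] .
qed

lemma H_pair_snd: "H (pair_pmf p q) (\<lambda>(w, v). Y v) = H q Y"
proof -
  have "map_pmf (\<lambda>(w, v). Y v) (pair_pmf p q) = map_pmf Y (map_pmf snd (pair_pmf p q))"
    by (simp add: map_pmf_comp split_def)
  then show ?thesis by (simp add: map_snd_pair_pmf)
qed

lemma H_pair: "H (pair_pmf p q) (\<lambda>(w, v). (X w, Y v)) = H p X + H q Y"
  by (simp add: map_pair ent_pair)

lemma rdist_map: "rdist y (map_pmf X p) = H (pair_pmf y p) (\<lambda>(u, w). u + X w) - (ent y + H p X) / 2"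
  by (simp add: rdist_def conv_def pair_map_pmf2 map_pmf_comp split_def)

lemma cdist_const: "cdist y p X (\<lambda>_. ()) = rdist y (map_pmf X p)"
  for p :: "'w::finite pmf"
proof -
  have "H p (\<lambda>w. (X w, ())) = H p X"
    "H (pair_pmf y p) (\<lambda>(u, w). (u + X w, ())) = H (pair_pmf y p) (\<lambda>(u, w). u + X w)"
    by (rule H_cong; auto)+
  then show ?thesis by (simp add: cdist_def rdist_map)
qed

text \<open>Conditions that determine each other have the same fibres, and on each fibre
  \<open>X\<close> is only translated by a constant.\<close>

lemma cdist_cong:
  fixes p :: "'w::finite pmf" and C :: "'w \<Rightarrow> 'c::finite" and D :: "'w \<Rightarrow> 'd::finite"
  assumes CD: "\<And>w. D w = f (C w)" "\<And>w. C w = g (D w)"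
    and XY: "\<And>w. Y w = X w + h (C w)"
  shows "cdist y p X C = cdist y p Y D"
proof -
  have *: "C w = C w' \<longleftrightarrow> D w = D w'" for w w' using CD by metis
  have "H p (\<lambda>w. (X w, C w)) = H p (\<lambda>w. (Y w, D w))"
    "H p C = H p D"
    "H (pair_pmf y p) (\<lambda>(u, w). (u + X w, C w)) = H (pair_pmf y p) (\<lambda>(u, w). (u + Y w, D w))"
    by (rule H_cong; auto simp: XY * simp flip: add.assoc; auto simp flip: *)+
  then show ?thesis by (simp add: cdist_def)
qed

text \<open>Conditioning costs at most half the mutual information of \<open>X\<close> and
  \<open>C\<close>, by subadditivity for \<open>u + X\<close> and \<open>C\<close>.\<close>

lemma cdist_le_rdist:
  fixes p :: "'w::finite pmf" and C :: "'w \<Rightarrow> 'c::finite"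
  shows "cdist y p X C \<le> rdist y (map_pmf X p) + (H p X + H p C - H p (\<lambda>w. (X w, C w))) / 2"
proof -
  have "H (pair_pmf y p) (\<lambda>w. (case w of (u, w) \<Rightarrow> u + X w, case w of (u, w) \<Rightarrow> C w))
      \<le> H (pair_pmf y p) (\<lambda>(u, w). u + X w) + H (pair_pmf y p) (\<lambda>(u, w). C w)"
    by (rule H_subadd)
  then show ?thesis
    using H_pair_snd[of C y p] by (simp add: cdist_def rdist_map field_simps split_def)
qed

text \<open>The Kaimanovich--Vershik--Madiman inequality, relative to a conditioning variable.\<close>

lemma cdist_add_le:
  fixes p :: "'w::finite pmf" and C :: "'w \<Rightarrow> 'c::finite"
  assumes indep: "H p (\<lambda>w. (X w, Z w, C w)) + H p C = H p (\<lambda>w. (X w, C w)) + H p (\<lambda>w. (Z w, C w))"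
  shows "cdist y p (\<lambda>w. X w + Z w) C
    \<le> cdist y p X C + (H p (\<lambda>w. (X w + Z w, C w)) - H p (\<lambda>w. (X w, C w))) / 2"
proof -
  let ?q = "pair_pmf y p"
  let ?S = "\<lambda>(u, w). (u + (X w + Z w), C w)"
  \<comment> \<open>Over \<open>?S\<close>, the variables \<open>u\<close> and \<open>Z\<close>
    together determine \<open>X\<close>, while \<open>u\<close> alone leaves \<open>X + Z\<close>
    and \<open>Z\<close> alone leaves \<open>u + X\<close>.\<close>
  have "H ?q (\<lambda>t. (fst t, Z (snd t), ?S t)) + H ?q ?S
      \<le> H ?q (\<lambda>t. (fst t, ?S t)) + H ?q (\<lambda>t. (Z (snd t), ?S t))"
    by (rule H_submod)
  moreover have "H ?q (\<lambda>t. (fst t, Z (snd t), ?S t)) = H ?q (\<lambda>(u, w). (u, (X w, Z w, C w)))"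
    by (rule H_cong) auto
  moreover have "H ?q (\<lambda>t. (fst t, ?S t)) = H ?q (\<lambda>(u, w). (u, (X w + Z w, C w)))"
    by (rule H_cong) auto
  moreover have "H ?q (\<lambda>t. (Z (snd t), ?S t)) = H ?q
      (\<lambda>t. (Z (snd t), fst t + X (snd t), C (snd t)))"
    by (rule H_cong) (auto simp flip: add.assoc)
  moreover have "H ?q (\<lambda>t. (Z (snd t), fst t + X (snd t), C (snd t))) + H ?q (\<lambda>t. C (snd t))
     \<le> H ?q (\<lambda>t. (Z (snd t), C (snd t))) + H ?q (\<lambda>t. (fst t + X (snd t), C (snd t)))"
    by (rule H_submod)
  moreover have "H ?q (\<lambda>t. C (snd t)) = H p C"
      "H ?q (\<lambda>t. (Z (snd t), C (snd t))) = H p (\<lambda>w. (Z w, C w))"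
    using H_pair_snd[of C y p] H_pair_snd[of "\<lambda>w. (Z w, C w)" y p] by (simp_all add: split_def)
  ultimately show ?thesis
    using indep H_pair[of "\<lambda>x. x" "\<lambda>w. (X w, Z w, C w)" y p]
        H_pair[of "\<lambda>x. x" "\<lambda>w. (X w + Z w, C w)" y p]
    by (simp add: cdist_def split_def field_simps)
qed

lemma rdist_add_le:
  fixes p :: "'w::finite pmf"
  assumes "H p (\<lambda>w. (X w, Z w)) = H p X + H p Z"
  shows "rdist y (map_pmf (\<lambda>w. X w + Z w) p)
    \<le> rdist y (map_pmf X p) + (H p (\<lambda>w. X w + Z w) - H p X) / 2"
proof -
  have e: "H p (\<lambda>w. (X w, ())) = H p X" "H p (\<lambda>w. (Z w, ())) = H p Z"
    "H p (\<lambda>w. (X w + Z w, ())) = H p (\<lambda>w. X w + Z w)"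
        "H p (\<lambda>w. (X w, Z w, ())) = H p (\<lambda>w. (X w, Z w))"
    by (rule H_cong; auto)+
  show ?thesis
    using cdist_add_le[where p=p and X=X and Z=Z and C="\<lambda>_. ()" and y=y] assms
    by (simp add: cdist_const e)
qed

section \<open>Independence as additivity of entropy\<close>

text \<open>Submodularity lets \<open>Y\<close> be coarsened to \<open>g (Y w)\<close> and then
  \<open>X\<close> to \<open>f (X w)\<close> without losing the lower bound; subadditivity is the
  converse.\<close>

lemma H_indep_map:
  fixes p :: "'w::finite pmf" and X :: "'w \<Rightarrow> 'a::finite" and Y :: "'w \<Rightarrow> 'b::finite"
    and f :: "'a \<Rightarrow> 'c::finite" and g :: "'b \<Rightarrow> 'd::finite"
  assumes "H p (\<lambda>w. (X w, Y w)) = H p X + H p Y"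
  shows "H p (\<lambda>w. (f (X w), g (Y w))) = H p (\<lambda>w. f (X w)) + H p (\<lambda>w. g (Y w))"
proof -
  have "H p (\<lambda>w. (X w, Y w, g (Y w))) + H p (\<lambda>w. g (Y w)) \<le> H p (\<lambda>w. (X w, g (Y w))) + H p
      (\<lambda>w. (Y w, g (Y w)))"
    by (rule H_submod)
  moreover have "H p (\<lambda>w. (X w, Y w, g (Y w))) = H p (\<lambda>w. (X w, Y w))"
      "H p (\<lambda>w. (Y w, g (Y w))) = H p Y"
    by (rule H_cong; auto)+
  ultimately have 1: "H p X + H p (\<lambda>w. g (Y w)) \<le> H p (\<lambda>w. (X w, g (Y w)))"
    using assms by linarith
  have "H p (\<lambda>w. (X w, g (Y w), f (X w))) + H p (\<lambda>w. f (X w)) \<le> H p (\<lambda>w. (X w, f (X w))) + H p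
      (\<lambda>w. (g (Y w), f (X w)))"
    by (rule H_submod)
  moreover have "H p (\<lambda>w. (X w, g (Y w), f (X w))) = H p (\<lambda>w. (X w, g (Y w)))"
      "H p (\<lambda>w. (X w, f (X w))) = H p X"
    "H p (\<lambda>w. (g (Y w), f (X w))) = H p (\<lambda>w. (f (X w), g (Y w)))"
    by (rule H_cong; auto)+
  ultimately have "H p (\<lambda>w. f (X w)) + H p (\<lambda>w. g (Y w)) \<le> H p (\<lambda>w. (f (X w), g (Y w)))"
    using 1 by linarith
  with H_subadd[where p=p and X="\<lambda>w. f (X w)" and Y="\<lambda>w. g (Y w)"] show ?thesis by linarith
qed

text \<open>Mutual independence as equality in subadditivity, so that its consequences follow from
  entropy inequalities by linear arithmetic.\<close>

definition indep4 :: "'w pmf \<Rightarrow> ('w \<Rightarrow> 'a::finite) \<Rightarrow> ('w \<Rightarrow> 'a) \<Rightarrow> ('w \<Rightarrow> 'a) \<Rightarrow> ('w \<Rightarrow> 'a) \<Rightarrow> bool" where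
  "indep4 p X1 X2 X3 X4 \<longleftrightarrow> H p (\<lambda>w. (X1 w, X2 w, X3 w, X4 w)) = H p X1 + H p X2 + H p X3 + H p X4"

lemma indep4_swap:
  fixes p :: "'w::finite pmf"
  assumes "indep4 p X1 X2 X3 X4"
  shows "indep4 p X2 X1 X3 X4" "indep4 p X1 X3 X2 X4" "indep4 p X1 X2 X4 X3"
proof -
  have "H p (\<lambda>w. (X2 w, X1 w, X3 w, X4 w)) = H p (\<lambda>w. (X1 w, X2 w, X3 w, X4 w))"
    "H p (\<lambda>w. (X1 w, X3 w, X2 w, X4 w)) = H p (\<lambda>w. (X1 w, X2 w, X3 w, X4 w))"
    "H p (\<lambda>w. (X1 w, X2 w, X4 w, X3 w)) = H p (\<lambda>w. (X1 w, X2 w, X3 w, X4 w))"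
    by (rule H_cong; auto)+
  then show "indep4 p X2 X1 X3 X4" "indep4 p X1 X3 X2 X4" "indep4 p X1 X2 X4 X3"
    using assms by (auto simp: indep4_def)
qed

text \<open>Splitting into pairs and then into single variables is a chain of subadditivities with
  equal ends, so each is an equality.\<close>

lemma indep4_pairs:
  fixes p :: "'w::finite pmf"
  assumes "indep4 p X1 X2 X3 X4"
  shows "H p (\<lambda>w. ((X1 w, X2 w), (X3 w, X4 w))) = H p (\<lambda>w. (X1 w, X2 w)) + H p (\<lambda>w. (X3 w, X4 w))"
    and "H p (\<lambda>w. (X1 w, X2 w)) = H p X1 + H p X2"
    and "H p (\<lambda>w. (X3 w, X4 w)) = H p X3 + H p X4"
proof -
  have "H p (\<lambda>w. ((X1 w, X2 w), (X3 w, X4 w))) = H p (\<lambda>w. (X1 w, X2 w, X3 w, X4 w))"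
    by (rule H_cong) auto
  then show "H p (\<lambda>w. ((X1 w, X2 w), (X3 w, X4 w))) = H p (\<lambda>w. (X1 w, X2 w)) + H p
      (\<lambda>w. (X3 w, X4 w))"
    and "H p (\<lambda>w. (X1 w, X2 w)) = H p X1 + H p X2"
    and "H p (\<lambda>w. (X3 w, X4 w)) = H p X3 + H p X4"
    using assms unfolding indep4_def
    using H_subadd[where p=p and X="\<lambda>w. (X1 w, X2 w)" and Y="\<lambda>w. (X3 w, X4 w)"]
      H_subadd[where p=p and X=X1 and Y=X2] H_subadd[where p=p and X=X3 and Y=X4]
    by linarith+
qed

text \<open>The average of two bounds: pass from \<open>X1\<close> to \<open>X1 + X2\<close> either after conditioning
  \<open>X1\<close> and \<open>X2\<close> on \<open>(X1 + X3, X2 + X4)\<close>, or before conditioning.\<close>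

lemma cdist_sum_given_sum_le:
  fixes p :: "'w::finite pmf" and X1 X2 X3 X4 :: "'w \<Rightarrow> 'a::char2_group"
  assumes indep: "indep4 p X1 X2 X3 X4"
  shows "cdist y p (\<lambda>w. X1 w + X2 w) (\<lambda>w. (X1 w + X3 w, X1 w + X2 w + X3 w + X4 w))
     \<le> rdist y (map_pmf X1 p)
       + (H p (\<lambda>w. X1 w + X2 w) + H p (\<lambda>w. X1 w + X3 w) - H p X1 - H p X3) / 2"
proof -
  let ?C = "\<lambda>w. (X1 w + X3 w, X1 w + X2 w + X3 w + X4 w)"
  let ?D = "\<lambda>w. (X1 w + X3 w, X2 w + X4 w)"
  note i13 = indep4_pairs[OF indep4_swap(2)[OF indep]]
  note i12 = indep4_pairs(2)[OF indep]
  have D: "H p ?D = H p (\<lambda>w. X1 w + X3 w) + H p (\<lambda>w. X2 w + X4 w)"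
    using H_indep_map[OF i13(1), of "\<lambda>(a, b). a + b" "\<lambda>(a, b). a + b"] by simp
  have C: "H p ?C = H p ?D"
    by (rule H_eqI[where f="\<lambda>(a, b). (a, b + a)" and g="\<lambda>(a, b). (a, a + b)"])
        (simp_all add: ac_simps)
  have X1D: "H p (\<lambda>w. (X1 w, ?D w)) = H p X1 + H p X3 + H p (\<lambda>w. X2 w + X4 w)"
  proof -
    have "H p (\<lambda>w. (X1 w, ?D w)) = H p (\<lambda>w. ((X1 w, X3 w), X2 w + X4 w))"
      by (rule H_cong) auto
    then show ?thesis
      using H_indep_map[OF i13(1), of "\<lambda>x. x" "\<lambda>(a, b). a + b"] i13(2) by simp
  qed
  have X2D: "H p (\<lambda>w. (X2 w, ?D w)) = H p X2 + H p X4 + H p (\<lambda>w. X1 w + X3 w)"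
  proof -
    have "H p (\<lambda>w. (X2 w, ?D w)) = H p (\<lambda>w. (X1 w + X3 w, (X2 w, X4 w)))"
      by (rule H_cong) auto
    then show ?thesis
      using H_indep_map[OF i13(1), of "\<lambda>(a, b). a + b" "\<lambda>x. x"] i13(3) by simp
  qed
  have X12D: "H p (\<lambda>w. (X1 w, X2 w, ?D w)) = H p X1 + H p X2 + H p X3 + H p X4"
  proof -
    have "H p (\<lambda>w. (X1 w, X2 w, ?D w)) = H p (\<lambda>w. (X1 w, X2 w, X3 w, X4 w))"
      by (rule H_cong) auto
    then show ?thesis using indep by (simp add: indep4_def)
  qed
  have T: "H p (\<lambda>w. (X1 w + X2 w, ?C w)) = H p (\<lambda>w. (X1 w + X2 w, ?D w))"
    by (rule H_eqI[where f="\<lambda>(c, a, b). (c, a, b + a)" and g="\<lambda>(c, a, b). (c, a, a + b)"])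
        (simp_all add: ac_simps)
  have "cdist y p (\<lambda>w. X1 w + X2 w) ?C
      \<le> rdist y (map_pmf (\<lambda>w. X1 w + X2 w) p)
          + (H p (\<lambda>w. X1 w + X2 w) + H p ?C - H p (\<lambda>w. (X1 w + X2 w, ?C w))) / 2"
    by (rule cdist_le_rdist)
  moreover have "rdist y (map_pmf (\<lambda>w. X1 w + X2 w) p)
      \<le> rdist y (map_pmf X1 p) + (H p (\<lambda>w. X1 w + X2 w) - H p X1) / 2"
    by (rule rdist_add_le) (rule i12)
  moreover have "cdist y p (\<lambda>w. X1 w + X2 w) ?C = cdist y p (\<lambda>w. X1 w + X2 w) ?D"
    by (rule cdist_cong[where h="\<lambda>_. 0" and f="\<lambda>(a, b). (a, b + a)" and g="\<lambda>(a, b). (a, a + b)"])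
        (simp_all add: ac_simps)
  moreover have "cdist y p (\<lambda>w. X1 w + X2 w) ?D
      \<le> cdist y p X1 ?D + (H p (\<lambda>w. (X1 w + X2 w, ?D w)) - H p (\<lambda>w. (X1 w, ?D w))) / 2"
    by (rule cdist_add_le) (simp add: D X1D X2D X12D)
  moreover have "cdist y p X1 ?D \<le> rdist y
      (map_pmf X1 p) + (H p X1 + H p ?D - H p (\<lambda>w. (X1 w, ?D w))) / 2"
    by (rule cdist_le_rdist)
  ultimately show ?thesis
    unfolding C T D X1D by argo
qed

text \<open>The entropic Balog--Szemeredi--Gowers step: conditioned on \<open>(A + B, S)\<close>, replace
  \<open>(A, B)\<close> by coordinates of two conditionally independent copies.\<close>

lemma rdist_minimal_BSG:
  fixes p :: "'w::finite pmf" and S :: "'w \<Rightarrow> 'c::finite" and A B :: "'w \<Rightarrow> 'a::char2_group"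
  assumes min: "\<And>x y. k \<le> rdist x y + \<eta> * (rdist x0 x - d1) + \<eta> * (rdist y0 y - d2)"
  defines "C \<equiv> \<lambda>w. (A w + B w, S w)"
  shows "k \<le> 2 * H p (\<lambda>w. (A w, S w)) + 2 * H p (\<lambda>w. (B w, S w)) + 2 * H p C
      - 3 * H p S - 3 * H p (\<lambda>w. (A w, B w, S w))
      + \<eta> * (cdist x0 p A C - d1) + \<eta> * (cdist y0 p B C - d2)"
proof -
  define K where "K = (\<lambda>c. cond_pmf p (C -` {c}))"
  define r where "r = map_pmf C p"
  \<comment> \<open>The law of \<open>((w, v), c)\<close>: two samples, conditionally independent
    given their common value \<open>c\<close> of \<open>C\<close>.\<close>
  define J where "J = joint r (\<lambda>c. pair_pmf (K c) (K c))"
  have rC: "joint r K = map_pmf (\<lambda>w. (w, C w)) p"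
    unfolding r_def K_def by (rule joint_cond_pmf[symmetric])
  have J1: "map_pmf (\<lambda>((w, v), c). (w, c)) J = map_pmf (\<lambda>w. (w, C w)) p"
    using map_joint[of "\<lambda>c. fst" r "\<lambda>c. pair_pmf (K c) (K c)"]
    by (simp add: J_def map_fst_pair_pmf rC split_def)
  have J2: "map_pmf (\<lambda>((w, v), c). (v, c)) J = map_pmf (\<lambda>w. (w, C w)) p"
    using map_joint[of "\<lambda>c. snd" r "\<lambda>c. pair_pmf (K c) (K c)"]
    by (simp add: J_def map_snd_pair_pmf rC split_def)
  have supp: "C w = c \<and> C v = c" if "((w, v), c) \<in> set_pmf J" for w v c
  proof -
    have "(w, c) \<in> set_pmf (map_pmf (\<lambda>((w, v), c). (w, c)) J)"
        "(v, c) \<in> set_pmf (map_pmf (\<lambda>((w, v), c). (v, c)) J)"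
      using that by force+
    then show ?thesis unfolding J1 J2 by auto
  qed
  have HJ1: "H J (\<lambda>((w, v), c). F w c) = H p (\<lambda>w. F w (C w))" for F :: "'w \<Rightarrow> 'a \<times> 'c \<Rightarrow> 'e::finite"
    using arg_cong[OF J1, of "map_pmf (\<lambda>(w, c). F w c)"] by (simp add: map_pmf_comp split_def)
  have HJ2: "H J (\<lambda>((w, v), c). F v c) = H p (\<lambda>w. F w (C w))" for F :: "'w \<Rightarrow> 'a \<times> 'c \<Rightarrow> 'e::finite"
    using arg_cong[OF J2, of "map_pmf (\<lambda>(w, c). F w c)"] by (simp add: map_pmf_comp split_def)
  have ci: "cond_indep J (\<lambda>t. f (fst (fst t))) (\<lambda>t. g (snd (fst t))) snd" for f :: "'w \<Rightarrow> 'd"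
      and g :: "'w \<Rightarrow> 'e"
  proof -
    have "map_pmf (\<lambda>t. ((f (fst (fst t)), g (snd (fst t))), snd t)) J
       = joint r (\<lambda>c. pair_pmf (map_pmf f (K c)) (map_pmf g (K c)))"
      using map_joint[of "\<lambda>c (w, v). (f w, g v)" r "\<lambda>c. pair_pmf (K c) (K c)"]
      by (simp add: J_def map_pair split_def) (simp add: map_pair[symmetric] split_def)
    moreover have "map_pmf snd J = r" by (simp add: J_def)
    ultimately show ?thesis
      unfolding cond_indep_def by (intro exI[of _ "\<lambda>c. map_pmf f (K c)"]
          exI[of _ "\<lambda>c. map_pmf g (K c)"]) simp
  qed
  let ?A = "\<lambda>t. A (fst (fst t))" and ?B = "\<lambda>t. B (fst (fst t))" and ?A' = "\<lambda>t. A (snd (fst t))"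
    and ?B' = "\<lambda>t. B (snd (fst t))" and ?S = "\<lambda>t::(('w \<times> 'w) \<times> ('a \<times> 'c)). snd (snd t)"
  have HC: "H J snd = H p C"
    using HJ1[of "\<lambda>w c. c"] by (simp add: split_def)
  have HAC: "H J (\<lambda>t. (?A t, snd t)) = H p (\<lambda>w. (A w, B w, S w))"
  proof -
    have "H J (\<lambda>t. (?A t, snd t)) = H p (\<lambda>w. (A w, C w))"
      using HJ1[of "\<lambda>w c. (A w, c)"] by (simp add: split_def)
    also have "\<dots> = H p (\<lambda>w. (A w, B w, S w))" by (rule H_cong) (auto simp: C_def)
    finally show ?thesis .
  qed
  have HBC: "H J (\<lambda>t. (?B' t, snd t)) = H p (\<lambda>w. (A w, B w, S w))"
  proof -
    have "H J (\<lambda>t. (?B' t, snd t)) = H p (\<lambda>w. (B w, C w))"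
      using HJ2[of "\<lambda>w c. (B w, c)"] by (simp add: split_def)
    also have "\<dots> = H p (\<lambda>w. (A w, B w, S w))" by (rule H_cong) (auto simp: C_def)
    finally show ?thesis .
  qed
  have cA: "cdist x0 J ?A snd = cdist x0 p A C"
  proof -
    have "map_pmf (\<lambda>t. (?A t, snd t)) J = joint r (\<lambda>c. map_pmf A (K c))"
      using map_joint[of "\<lambda>c (w, v). A w" r "\<lambda>c. pair_pmf (K c) (K c)"]
      by (simp add: J_def split_def)
          (simp add: map_pmf_comp[symmetric, of A fst] map_fst_pair_pmf del: map_pmf_comp)
    moreover have "map_pmf (\<lambda>w. (A w, C w)) p = joint r (\<lambda>c. map_pmf A (K c))"
      using map_joint[of "\<lambda>c. A" r K] by (simp add: rC map_pmf_comp)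
    ultimately show ?thesis by (simp add: cdist_joint)
  qed
  have cB: "cdist y0 J ?B' snd = cdist y0 p B C"
  proof -
    have "map_pmf (\<lambda>t. (?B' t, snd t)) J = joint r (\<lambda>c. map_pmf B (K c))"
      using map_joint[of "\<lambda>c (w, v). B v" r "\<lambda>c. pair_pmf (K c) (K c)"]
      by (simp add: J_def split_def)
          (simp add: map_pmf_comp[symmetric, of B snd] map_snd_pair_pmf del: map_pmf_comp)
    moreover have "map_pmf (\<lambda>w. (B w, C w)) p = joint r (\<lambda>c. map_pmf B (K c))"
      using map_joint[of "\<lambda>c. B" r K] by (simp add: rC map_pmf_comp)
    ultimately show ?thesis by (simp add: cdist_joint)
  qed
  \<comment> \<open>Minimality is tested on \<open>A\<close> of the first sample and
    \<open>B\<close> of the second.\<close>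
  have "k \<le> H J (\<lambda>t. (?A t + ?B' t, snd t))
      - (H J (\<lambda>t. (?A t, snd t)) + H J (\<lambda>t. (?B' t, snd t))) / 2
      + \<eta> * (cdist x0 J ?A snd - d1) + \<eta> * (cdist y0 J ?B' snd - d2)"
    by (rule rdist_minimal_cond[OF min ci])
  then have 1: "k \<le> H J (\<lambda>t. (?A t + ?B' t, snd t)) - H p (\<lambda>w. (A w, B w, S w))
      + \<eta> * (cdist x0 p A C - d1) + \<eta> * (cdist y0 p B C - d2)"
    by (simp add: HAC HBC cA cB)
  let ?D = "\<lambda>t. (?A t + ?B' t, ?S t)"
  have S: "H J ?S = H p S" using HJ1[of "\<lambda>w c. snd c"] by (simp add: split_def C_def)
  have SA: "H J (\<lambda>t. (?A t, ?S t)) = H p (\<lambda>w. (A w, S w))" using HJ1[of "\<lambda>w c. (A w, snd c)"] by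
      (simp add: split_def C_def)
  have SB: "H J (\<lambda>t. (?B t, ?S t)) = H p (\<lambda>w. (B w, S w))" using HJ1[of "\<lambda>w c. (B w, snd c)"] by
      (simp add: split_def C_def)
  have SA': "H J (\<lambda>t. (?A' t, ?S t)) = H p (\<lambda>w. (A w, S w))" using HJ2[of "\<lambda>w c. (A w, snd c)"] by
      (simp add: split_def C_def)
  have SB': "H J (\<lambda>t. (?B' t, ?S t)) = H p (\<lambda>w. (B w, S w))" using HJ2[of "\<lambda>w c. (B w, snd c)"] by
      (simp add: split_def C_def)
  \<comment> \<open>Trades the condition \<open>(A + B, S)\<close> for \<open>S\<close> alone;
    \<open>H J ?D\<close> is then bounded by \<open>3\<close>.\<close>
  have 2: "H J (\<lambda>t. (?A t + ?B' t, snd t)) + H p S \<le> H J ?D + H p C"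
  proof -
    have "H J (\<lambda>t. (?A t + ?B' t, fst (snd t), ?S t)) + H J ?S \<le> H J ?D + H J
        (\<lambda>t. (fst (snd t), ?S t))"
      by (rule H_submod)
    then show ?thesis by (simp add: S HC)
  qed
  have eq: "?A t + ?B t = fst (snd t) \<and> ?A' t + ?B' t = fst (snd t)" if "t \<in> set_pmf J" for t
    using supp[of "fst (fst t)" "snd (fst t)" "snd t"] that by (auto simp: C_def prod_eq_iff)
  have 3: "H J (\<lambda>t. (?A t, ?B t, ?D t)) + H J ?D \<le> H J (\<lambda>t. (?A t, ?D t)) + H J (\<lambda>t. (?B t, ?D t))"
    by (rule H_submod)
  have 4: "H J (\<lambda>t. (?A t, ?D t)) + H p S \<le> H p (\<lambda>w. (A w, S w)) + H p (\<lambda>w. (B w, S w))"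
  proof -
    have "H J (\<lambda>t. (?A t, ?D t)) = H J (\<lambda>t. (?A t, ?B' t, ?S t))" by (rule H_cong) auto
    then show ?thesis using H_submod[where p=J and X="?A" and Y="?B'" and Z="?S"] by
        (simp only: S SA SB')
  qed
  have 5: "H J (\<lambda>t. (?B t, ?D t)) + H p S \<le> H p (\<lambda>w. (A w, S w)) + H p (\<lambda>w. (B w, S w))"
  proof -
    \<comment> \<open>The two samples have equal sums, so in exponent two \<open>?D\<close> can also
      be computed from \<open>?B\<close> and \<open>?A'\<close>.\<close>
    have sw: "?A t + ?B' t = ?B t + ?A' t" if "t \<in> set_pmf J" for t
    proof -
      have "?A t + ?B t = ?A' t + ?B' t" using eq[OF that] by simp
      then have "?A t + ?B t + (?B t + ?B' t) = ?A' t + ?B' t + (?B t + ?B' t)" by simp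
      then show ?thesis by (simp add: ac_simps)
    qed
    have "H J (\<lambda>t. (?B t, ?D t)) = H J (\<lambda>t. (?B t, ?A' t, ?S t))" by (rule H_cong) (auto simp: sw)
    then show ?thesis using H_submod[where p=J and X="?B" and Y="?A'" and Z="?S"] by
        (simp only: S SB SA')
  qed
  have 6: "H J (\<lambda>t. (?A t, ?B t, ?D t)) + H p C = 2 * H p (\<lambda>w. (A w, B w, S w))"
  proof -
    let ?P = "\<lambda>t. (?A t, ?B t)" and ?Q = "\<lambda>t. (?A' t, ?B' t)"
    \<comment> \<open>\<open>?D\<close> gives \<open>?B'\<close>, the first pair gives the common
      sum, and these give \<open>?A'\<close>, so both pairs are recovered.\<close>
    have "H J (\<lambda>t. (?A t, ?B t, ?D t)) = H J (\<lambda>t. (?P t, ?Q t, snd t))"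
    proof (rule H_cong)
      fix t t' assume t: "t \<in> set_pmf J" "t' \<in> set_pmf J"
      show "((?A t, ?B t, ?D t) = (?A t', ?B t', ?D t'))
          = ((?P t, ?Q t, snd t) = (?P t', ?Q t', snd t'))"
      proof
        assume l: "(?A t, ?B t, ?D t) = (?A t', ?B t', ?D t')"
        then have "?B' t = ?B' t'" by auto
        moreover have "fst (snd t) = fst (snd t')" using eq[OF t(1)] eq[OF t(2)] l by auto
        moreover from this have "?A' t = ?A' t'" using eq[OF t(1)] eq[OF t(2)] calculation
          by (metis add_right_cancel)
        ultimately show "(?P t, ?Q t, snd t) = (?P t', ?Q t', snd t')" using l by
            (auto simp: prod_eq_iff)
      qed auto
    qed
    moreover have "H J (\<lambda>t. (?P t, ?Q t, snd t)) + H J snd = H J (\<lambda>t. (?P t, snd t)) + H J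
        (\<lambda>t. (?Q t, snd t))"
      by (rule cond_indep_H[OF ci[of "\<lambda>w. (A w, B w)" "\<lambda>w. (A w, B w)"]])
    moreover have "H J (\<lambda>t. (?P t, snd t)) = H p (\<lambda>w. ((A w, B w), C w))"
      using HJ1[of "\<lambda>w c. ((A w, B w), c)"] by (simp add: split_def)
    moreover have "H J (\<lambda>t. (?Q t, snd t)) = H p (\<lambda>w. ((A w, B w), C w))"
      using HJ2[of "\<lambda>w c. ((A w, B w), c)"] by (simp add: split_def)
    moreover have "H p (\<lambda>w. ((A w, B w), C w)) = H p (\<lambda>w. (A w, B w, S w))"
      by (rule H_cong) (auto simp: C_def)
    ultimately show ?thesis using HC by linarith
  qed
  show ?thesis using 1 2 3 4 5 6 by argo
qed

subsection \<open>Minimizers have distance zero\<close>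

lemma map_add_pair: "map_pmf (\<lambda>(w, v). f w + g v) (pair_pmf p q) = conv (map_pmf f p) (map_pmf g q)"
  by (simp add: conv_def map_pair[symmetric] map_pmf_comp split_def)

lemma conv_commute: "conv x y = conv y (x :: 'a::ab_semigroup_add pmf)"
  unfolding conv_def by (subst pair_commute_pmf) (simp add: map_pmf_comp split_def add.commute)

text \<open>Needed to read the sum of four independent variables both as two mixed sums and as two
  sums of equally distributed terms.\<close>

lemma pair_interchange:
  fixes x :: "'a pmf" and y :: "'b pmf" and z :: "'c pmf" and t :: "'d pmf"
  shows "pair_pmf (pair_pmf x y) (pair_pmf z t)
    = map_pmf (\<lambda>((a, c), (b, d)). ((a, b), (c, d))) (pair_pmf (pair_pmf x z) (pair_pmf y t))"
proof (rule pmf_eqI, clarify)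
  define g :: "('a \<times> 'c) \<times> 'b \<times> 'd \<Rightarrow> ('a \<times> 'b) \<times> 'c \<times> 'd"
      where "g = (\<lambda>((a, c), (b, d)). ((a, b), (c, d)))"
  fix a b c d
  have "inj g" by (auto simp: inj_def g_def)
  from pmf_map_inj'[OF this, of _ "((a, c), (b, d))"]
  show "pmf (pair_pmf (pair_pmf x y) (pair_pmf z t)) ((a, b), (c, d))
      = pmf (map_pmf (\<lambda>((a, c), (b, d)). ((a, b), (c, d))) (pair_pmf (pair_pmf x z) (pair_pmf y t)))
          ((a, b), (c, d))"
    by (simp add: pmf_pair g_def)
qed

lemma cond_indep_map:
  "cond_indep (map_pmf f p) X Y C \<longleftrightarrow> cond_indep p (\<lambda>w. X (f w)) (\<lambda>w. Y (f w)) (\<lambda>w. C (f w))"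
  by (simp add: cond_indep_def map_pmf_comp)

text \<open>The map \<open>(u, v) \<mapsto> (u + v, v)\<close> is injective, so
  \<open>ent x + ent y\<close> is the joint entropy of the sum and \<open>v\<close>; subadditivity
  removes \<open>ent y\<close>.\<close>

lemma ent_conv_ge: "ent x \<le> ent (conv x (y :: 'a::char2_group pmf))"
proof -
  let ?p = "pair_pmf x y"
  have "H ?p (\<lambda>w. w) = H ?p (\<lambda>w. (fst w + snd w, snd w))"
    by (rule H_cong) (auto simp: prod_eq_iff)
  moreover have "H ?p snd = ent y" by (simp add: map_snd_pair_pmf)
  ultimately show ?thesis
    using H_subadd[where p="?p" and X="\<lambda>w. fst w + snd w" and Y=snd]
    by (simp add: conv_def split_def ent_pair)
qed

lemma rdist_commute: "rdist x y = rdist y x"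
  by (simp add: rdist_def conv_commute[of x y] add.commute)

lemma rdist_nonneg: "0 \<le> rdist x y"
  using ent_conv_ge[of x y] ent_conv_ge[of y x] by (simp add: rdist_def conv_commute[of x y])

text \<open>Read \<open>D\<close> as the sum of the self-distances of the two minimizers \<open>X1\<close>, \<open>X2\<close>, and with
  \<open>\<sigma> = (H X1 + H X2) / 2\<close> read \<open>s\<close> as the entropy of the sum of two independent copies of each
  minus \<open>\<sigma>\<close>, and \<open>t\<close> as the joint entropy of all pairwise sums of these copies minus \<open>3 \<sigma>\<close>.
  The multiplier \<open>b\<close> is chosen to eliminate \<open>D\<close>; then \<open>s + t\<close> drops out as well.\<close>

lemma minimal_distance_arith:
  fixes k s t D \<eta> :: real
  assumes \<eta>: "0 < \<eta>" "\<eta> < 1 / 8" and k: "0 \<le> k"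
    and 1: "k \<le> s - k + \<eta> * k" and 2: "k \<le> t - k + \<eta> * k"
    and 3: "k \<le> s - D / 2 + \<eta> * D / 2" and 4: "k \<le> t - D / 2 + \<eta> * D / 2"
    and 5: "k \<le> 8 * k + 2 * D - 3 * (s + t) + 2 * \<eta> * k"
    and 6: "k \<le> 8 * k + 2 * D - 3 * (s + t) + \<eta> * (k + D / 2)"
  shows "k = 0"
proof -
  define b where "b = (2 + \<eta> / 6) / (1 - \<eta>)"
  have b\<eta>: "b * \<eta> = b - 2 - \<eta> / 6"
    using \<eta> by (simp add: b_def field_simps)
  have b: "0 \<le> b" "b \<le> 3" using \<eta> by (simp_all add: b_def field_simps)
  \<comment> \<open>The nonnegative weights \<open>3 - b\<close> on \<open>1 + 2\<close> and
    \<open>b\<close> on \<open>3 + 4\<close> add up to the coefficient 3 of \<open>s + t\<close> in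
    \<open>5\<close> and \<open>6\<close>.\<close>
  have "(3 - b) * ((4 - 2 * \<eta>) * k) \<le> (3 - b) * (s + t)"
    using 1 2 b by (intro mult_left_mono) (auto simp: algebra_simps)
  moreover have "b * (2 * k + (1 - \<eta>) * D) \<le> b * (s + t)"
    using 3 4 b by (intro mult_left_mono) (auto simp: algebra_simps)
  ultimately have "(3 - b) * ((4 - 2 * \<eta>) * k) + b * (2 * k + (1 - \<eta>) * D) \<le> 3 * (s + t)"
    by (simp add: algebra_simps)
  moreover have "(3 - b) * ((4 - 2 * \<eta>) * k) + b * (2 * k + (1 - \<eta>) * D)
     = 12 * k - 6 * \<eta> * k - 2 * b * k + 2 * (b * \<eta>) * k + (b - b * \<eta>) * D"
    by (simp add: algebra_simps)
  moreover have "\<dots> = 8 * k - 6 * \<eta> * k - \<eta> / 3 * k + (2 + \<eta> / 6) * D"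
    unfolding b\<eta> by (simp add: algebra_simps)
  \<comment> \<open>Weights 2/3 on \<open>5\<close> and 1/3 on \<open>6\<close> produce the same
    coefficient \<open>2 + \<eta> / 6\<close> of \<open>D\<close>; the multiples 19/3 and 5/3 of
    \<open>\<eta> * k\<close> add up to 8.\<close>
  ultimately have "k \<le> 8 * \<eta> * k" using 5 6 by (simp add: algebra_simps)
  then have "k * (1 - 8 * \<eta>) \<le> 0" by (simp add: algebra_simps)
  moreover have "0 < 1 - 8 * \<eta>" using \<eta> by simp
  ultimately have "k \<le> 0" by (simp add: mult_le_0_iff)
  then show ?thesis using k by simp
qed

text \<open>The hypothesis is minimality with the penalties written as increments. Each of
  \<open>N1\<close> to \<open>N6\<close> is one test of it, and all are linear in the same few
  entropies.\<close>

lemma minimal_distance_zero: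
  fixes x0 y0 x1 x2 :: "'a::char2_group pmf"
  assumes \<eta>: "0 < \<eta>" "\<eta> < 1 / 8"
    and min: "\<And>x y. rdist x1 x2 \<le> rdist x y + \<eta> * (rdist x0 x - rdist x0 x1) + \<eta> *
        (rdist y0 y - rdist y0 x2)"
  shows "rdist x1 x2 = 0"
proof -
  \<comment> \<open>Under \<open>p\<close> the variables \<open>a\<close>, \<open>b\<close>,
    \<open>c\<close>, \<open>d\<close> below are independent, \<open>a\<close> and \<open>c\<close>
    of law \<open>x1\<close>, \<open>b\<close> and \<open>d\<close> of law
    \<open>x2\<close>.\<close>
  define p where "p = pair_pmf (pair_pmf x1 x2) (pair_pmf x1 x2)"
  define a b c d :: "('a \<times> 'a) \<times> 'a \<times> 'a \<Rightarrow> 'a"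
    where "a = (\<lambda>w. fst (fst w))" and "b = (\<lambda>w. snd (fst w))" and "c = (\<lambda>w. fst (snd w))" and
        "d = (\<lambda>w. snd (snd w))"
  note abcd = a_def b_def c_def d_def
  have laws: "map_pmf a p = x1" "map_pmf b p = x2" "map_pmf c p = x1" "map_pmf d p = x2"
    by (simp_all add: p_def abcd map_pmf_comp[symmetric, of fst fst]
        map_pmf_comp[symmetric, of snd fst]
      map_pmf_comp[symmetric, of fst snd]
          map_pmf_comp[symmetric, of snd snd] map_fst_pair_pmf map_snd_pair_pmf
      del: map_pmf_comp)
  \<comment> \<open>The same variables grouped by law, for the tests that pair \<open>a\<close> with
    \<open>c\<close> and \<open>b\<close> with \<open>d\<close>.\<close>
  define p' where "p' = pair_pmf (pair_pmf x1 x1) (pair_pmf x2 x2)"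
  have pp': "p = map_pmf (\<lambda>t. ((fst (fst t), fst (snd t)), (snd (fst t), snd (snd t)))) p'"
    unfolding p_def p'_def by (subst pair_interchange) (simp add: split_def)
  have sums: "map_pmf (\<lambda>w. a w + b w) p = conv x1 x2" "map_pmf (\<lambda>w. c w + d w) p = conv x1 x2"
    "map_pmf (\<lambda>w. a w + d w) p = conv x1 x2" "map_pmf (\<lambda>w. b w + c w) p = conv x2 x1"
    "map_pmf (\<lambda>w. a w + c w) p = conv x1 x1" "map_pmf (\<lambda>w. b w + d w) p = conv x2 x2"
  proof -
    have f: "map_pmf (\<lambda>w. f (fst w)) (pair_pmf u v) = map_pmf f u"
        "map_pmf (\<lambda>w. g (snd w)) (pair_pmf u v) = map_pmf g v"
      for u :: "'b pmf" and v :: "'c pmf" and f :: "'b \<Rightarrow> 'e" and g :: "'c \<Rightarrow> 'e"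
      using arg_cong[OF map_fst_pair_pmf[of u v], of "map_pmf f"]
          arg_cong[OF map_snd_pair_pmf[of u v], of "map_pmf g"]
      by (simp_all add: map_pmf_comp)
    show "map_pmf (\<lambda>w. a w + b w) p = conv x1 x2" "map_pmf (\<lambda>w. c w + d w) p = conv x1 x2"
      unfolding abcd p_def
      by (simp_all add: f(1)[of "\<lambda>w. fst w + snd w"] f(2)[of "\<lambda>w. fst w + snd w"] conv_def
          split_def)
    show "map_pmf (\<lambda>w. a w + d w) p = conv x1 x2" "map_pmf (\<lambda>w. b w + c w) p = conv x2 x1"
      using map_add_pair[of fst snd "pair_pmf x1 x2" "pair_pmf x1 x2"]
          map_add_pair[of snd fst "pair_pmf x1 x2" "pair_pmf x1 x2"]
      by (simp_all add: abcd p_def split_def map_fst_pair_pmf map_snd_pair_pmf)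
    show "map_pmf (\<lambda>w. a w + c w) p = conv x1 x1" "map_pmf (\<lambda>w. b w + d w) p = conv x2 x2"
      unfolding pp' abcd map_pmf_comp p'_def
      by (simp_all add: f(1)[of "\<lambda>w. fst w + snd w"] f(2)[of "\<lambda>w. fst w + snd w"] conv_def
          split_def)
  qed
  \<comment> \<open>The three variables in \<open>T\<close> generate all pairwise sums, so any other
    generating triple has the same joint entropy.\<close>
  define h1 h2 h12 h11 h22 s T where "h1 = ent x1" and "h2 = ent x2" and "h12 = ent (conv x1 x2)"
    and "h11 = ent (conv x1 x1)" and "h22 = ent (conv x2 x2)"
    and "s = H p (\<lambda>w. a w + b w + c w + d w)"
    and "T = H p (\<lambda>w. (a w + b w, b w + c w, a w + b w + c w + d w))"
  note hs = h1_def[symmetric] h2_def[symmetric] h12_def[symmetric] h11_def[symmetric]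
      h22_def[symmetric]
  note HS = laws sums hs conv_commute[of x2 x1]
  have indep: "indep4 p a b c d"
  proof -
    have "H p (\<lambda>w. (a w, b w, c w, d w)) = H p (\<lambda>w. w)" by (rule H_cong)
        (auto simp: abcd prod_eq_iff)
    then show ?thesis unfolding indep4_def by (simp add: HS) (simp add: p_def ent_pair hs)
  qed
  note indep_adbc = indep4_swap(2)[OF indep4_swap(3)[OF indep]]
  note indep_bcad = indep4_swap(2)[OF indep4_swap(1)[OF indep]]
  note indep_bcda = indep4_swap(3)[OF indep_bcad]
  note indep_acbd = indep4_swap(2)[OF indep]
  define k D where "k = rdist x1 x2" and "D = h11 + h22 - h1 - h2"
  have k: "k = h12 - (h1 + h2) / 2" by (simp add: k_def rdist_def hs)
  have min': "k \<le> rdist x y + \<eta> * (rdist x0 x - rdist x0 x1) + \<eta> * (rdist y0 y - rdist y0 x2)" for x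
      y
    unfolding k_def by (rule min)
  \<comment> \<open>Replaces the penalty increments by upper bounds \<open>u\<close>,
    \<open>v\<close>; this uses that \<open>\<eta>\<close> is positive.\<close>
  have minD: "k \<le> m + \<eta> * (u + v)" if "k \<le> m + \<eta> * (u' - rdist x0 x1) + \<eta> * (v' - rdist y0 x2)"
      "u' \<le> rdist x0 x1 + u" "v' \<le> rdist y0 x2 + v" for m u v u' v'
  proof -
    have "\<eta> * (u' - rdist x0 x1) \<le> \<eta> * u" "\<eta> * (v' - rdist y0 x2) \<le> \<eta> * v"
      using that \<eta> by (auto intro!: mult_left_mono)
    then show ?thesis using that(1) by (simp add: algebra_simps)
  qed
  have HUS: "H p (\<lambda>w. (a w + b w, c w + d w)) = 2 * h12"
    using H_indep_map[OF indep4_pairs(1)[OF indep], of "\<lambda>(x, y). x + y" "\<lambda>(x, y). x + y"] by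
        (simp add: HS)
  have HVS: "H p (\<lambda>w. (b w + c w, a w + d w)) = 2 * h12"
    using H_indep_map[OF indep4_pairs(1)[OF indep_bcad], of "\<lambda>(x, y). x + y" "\<lambda>(x, y). x + y"] by
        (simp add: HS)
  have HWS: "H p (\<lambda>w. (a w + c w, b w + d w)) = h11 + h22"
    using H_indep_map[OF indep4_pairs(1)[OF indep_acbd], of "\<lambda>(x, y). x + y" "\<lambda>(x, y). x + y"] by
        (simp add: HS)
  \<comment> \<open>Test on two independent mixed sums.\<close>
  have N1: "k \<le> (s - h12) + \<eta> * ((h12 - h1) / 2 + (h12 - h2) / 2)"
  proof (rule minD)
    have "map_pmf (\<lambda>w. a w + b w + c w + d w) p = conv (conv x1 x2) (conv x1 x2)"
      using map_add_pair[of "\<lambda>w. fst w + snd w" "\<lambda>w. fst w + snd w" "pair_pmf x1 x2"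
          "pair_pmf x1 x2"]
      by (simp add: abcd p_def split_def conv_def add.assoc)
    then have "rdist (conv x1 x2) (conv x1 x2) = s - h12" by (simp add: rdist_def s_def h12_def)
    then show "k \<le> (s - h12) + \<eta> * (rdist x0 (conv x1 x2) - rdist x0 x1) + \<eta> *
        (rdist y0 (conv x1 x2) - rdist y0 x2)"
      using min'[of "conv x1 x2" "conv x1 x2"] by simp
    show "rdist x0 (conv x1 x2) \<le> rdist x0 x1 + (h12 - h1) / 2"
      using rdist_add_le[OF indep4_pairs(2)[OF indep], of x0] by (simp add: HS)
    show "rdist y0 (conv x1 x2) \<le> rdist y0 x2 + (h12 - h2) / 2"
      using rdist_add_le[OF indep4_pairs(2)[OF indep_bcad], of y0] by (simp add: HS)
  qed
  \<comment> \<open>Test on \<open>a + c\<close> and \<open>b + d\<close>, which brings in the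
    self-distances.\<close>
  have N3: "k \<le> (s - (h11 + h22) / 2) + \<eta> * ((h11 - h1) / 2 + (h22 - h2) / 2)"
  proof (rule minD)
    have "map_pmf (\<lambda>w. a w + b w + c w + d w) p = conv (conv x1 x1) (conv x2 x2)"
      unfolding pp' abcd map_pmf_comp p'_def
      using map_add_pair[of "\<lambda>w. fst w + snd w" "\<lambda>w. fst w + snd w" "pair_pmf x1 x1"
          "pair_pmf x2 x2"]
      by (simp add: split_def conv_def ac_simps)
    then have "rdist (conv x1 x1) (conv x2 x2) = s - (h11 + h22) / 2" by
        (simp add: rdist_def s_def hs)
    then show "k \<le> (s - (h11 + h22) / 2) + \<eta> * (rdist x0 (conv x1 x1) - rdist x0 x1) + \<eta> *
        (rdist y0 (conv x2 x2) - rdist y0 x2)"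
      using min'[of "conv x1 x1" "conv x2 x2"] by simp
    show "rdist x0 (conv x1 x1) \<le> rdist x0 x1 + (h11 - h1) / 2"
      using rdist_add_le[OF indep4_pairs(2)[OF indep_acbd], of x0] by (simp add: HS)
    show "rdist y0 (conv x2 x2) \<le> rdist y0 x2 + (h22 - h2) / 2"
      using rdist_add_le[OF indep4_pairs(3)[OF indep_acbd], of y0] by (simp add: HS)
  qed
  \<comment> \<open>Conditioned companion of \<open>N1\<close>: \<open>a\<close> and
    \<open>d\<close> given \<open>(a + b, c + d)\<close>. With the condition, \<open>a + d\<close>
    generates all pairwise sums, hence \<open>T\<close>.\<close>
  have N2: "k \<le> (T - (h1 + h2 + h12)) + \<eta> * ((h12 - h2) / 2 + (h12 - h1) / 2)"
  proof (rule minD)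
    let ?C = "\<lambda>w. (a w + b w, c w + d w)"
    have "cond_indep p a d ?C"
      using cond_indep_pair[where p="pair_pmf x1 x2" and q="pair_pmf x1 x2" and X=fst and Y=snd
          and C="\<lambda>w. fst w + snd w" and D="\<lambda>w. fst w + snd w"]
      by (simp add: p_def abcd split_def)
    note m = rdist_minimal_cond[OF min' this]
    have T: "H p (\<lambda>w. (a w + d w, ?C w)) = T"
      unfolding T_def
      by (rule H_eqI[where f="\<lambda>(x, y, z). (y, x + y + z, y + z)"
          and g="\<lambda>(x, y, z). (y + z, x, x + z)"])
         (auto simp: ac_simps)
    have aC: "H p (\<lambda>w. (a w, ?C w)) = h1 + h2 + h12"
    proof -
      have "H p (\<lambda>w. (a w, ?C w)) = H p (\<lambda>w. ((a w, b w), c w + d w))" by (rule H_cong) auto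
      then show ?thesis
        using H_indep_map[OF indep4_pairs(1)[OF indep], of "\<lambda>x. x" "\<lambda>(x, y). x + y"]
            indep4_pairs(2)[OF indep]
        by (simp add: HS)
    qed
    have dC: "H p (\<lambda>w. (d w, ?C w)) = h1 + h2 + h12"
    proof -
      have "H p (\<lambda>w. (d w, ?C w)) = H p (\<lambda>w. (a w + b w, (c w, d w)))" by (rule H_cong) auto
      then show ?thesis
        using H_indep_map[OF indep4_pairs(1)[OF indep], of "\<lambda>(x, y). x + y" "\<lambda>x. x"]
            indep4_pairs(3)[OF indep]
        by (simp add: HS)
    qed
    show "k \<le> (T - (h1 + h2 + h12)) + \<eta> * (cdist x0 p a ?C - rdist x0 x1) + \<eta> *
        (cdist y0 p d ?C - rdist y0 x2)"
      using m unfolding T aC dC by argo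
    show "cdist x0 p a ?C \<le> rdist x0 x1 + (h12 - h2) / 2"
      using cdist_le_rdist[of x0 p a ?C] by (simp add: aC HUS HS field_simps)
    show "cdist y0 p d ?C \<le> rdist y0 x2 + (h12 - h1) / 2"
      using cdist_le_rdist[of y0 p d ?C] by (simp add: dC HUS HS field_simps)
  qed
  \<comment> \<open>Conditioned companion of \<open>N3\<close>: \<open>a\<close> and
    \<open>b\<close> given \<open>(a + c, b + d)\<close>.\<close>
  have N4: "k \<le> (T - (2 * h1 + 2 * h2 + h11 + h22) / 2) + \<eta> * ((h11 - h1) / 2 + (h22 - h2) / 2)"
  proof (rule minD)
    let ?C = "\<lambda>w. (a w + c w, b w + d w)"
    have "cond_indep p a b ?C"
      using cond_indep_pair[where p="pair_pmf x1 x1" and q="pair_pmf x2 x2" and X=fst and Y=fst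
          and C="\<lambda>w. fst w + snd w" and D="\<lambda>w. fst w + snd w"]
      by (simp add: pp' cond_indep_map p'_def abcd split_def)
    note m = rdist_minimal_cond[OF min' this]
    have T: "H p (\<lambda>w. (a w + b w, ?C w)) = T"
      unfolding T_def
      by (rule H_eqI[where f="\<lambda>(x, y, z). (x, x + y, y + z)"
          and g="\<lambda>(x, y, z). (x, x + y, x + y + z)"])
         (auto simp: ac_simps)
    have aC: "H p (\<lambda>w. (a w, ?C w)) = 2 * h1 + h22"
    proof -
      have "H p (\<lambda>w. (a w, ?C w)) = H p (\<lambda>w. ((a w, c w), b w + d w))" by (rule H_cong) auto
      then show ?thesis
        using H_indep_map[OF indep4_pairs(1)[OF indep_acbd], of "\<lambda>x. x" "\<lambda>(x, y). x + y"]
            indep4_pairs(2)[OF indep_acbd]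
        by (simp add: HS)
    qed
    have bC: "H p (\<lambda>w. (b w, ?C w)) = 2 * h2 + h11"
    proof -
      have "H p (\<lambda>w. (b w, ?C w)) = H p (\<lambda>w. (a w + c w, (b w, d w)))" by (rule H_cong) auto
      then show ?thesis
        using H_indep_map[OF indep4_pairs(1)[OF indep_acbd], of "\<lambda>(x, y). x + y" "\<lambda>x. x"]
            indep4_pairs(3)[OF indep_acbd]
        by (simp add: HS)
    qed
    show "k \<le> (T - (2 * h1 + 2 * h2 + h11 + h22) / 2) + \<eta> * (cdist x0 p a ?C - rdist x0 x1) + \<eta> *
        (cdist y0 p b ?C - rdist y0 x2)"
      using m unfolding T aC bC by argo
    show "cdist x0 p a ?C \<le> rdist x0 x1 + (h11 - h1) / 2"
      using cdist_le_rdist[of x0 p a ?C] by (simp add: aC HWS HS field_simps)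
    show "cdist y0 p b ?C \<le> rdist y0 x2 + (h22 - h2) / 2"
      using cdist_le_rdist[of y0 p b ?C] by (simp add: bC HWS HS field_simps)
  qed
  let ?S = "\<lambda>w. a w + b w + c w + d w"
  have US: "H p (\<lambda>w. (a w + b w, ?S w)) = 2 * h12"
    unfolding HUS[symmetric]
    by (rule H_eqI[where f="\<lambda>(x, y). (x, x + y)" and g="\<lambda>(x, y). (x, x + y)"]) (auto simp: ac_simps)
  have VS: "H p (\<lambda>w. (b w + c w, ?S w)) = 2 * h12"
    unfolding HVS[symmetric]
    by (rule H_eqI[where f="\<lambda>(x, y). (x, x + y)" and g="\<lambda>(x, y). (x, x + y)"]) (auto simp: ac_simps)
  have WS: "H p (\<lambda>w. (a w + c w, ?S w)) = h11 + h22"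
    unfolding HWS[symmetric]
    by (rule H_eqI[where f="\<lambda>(x, y). (x, x + y)" and g="\<lambda>(x, y). (x, x + y)"]) (auto simp: ac_simps)
  \<comment> \<open>The sums \<open>b + c\<close> and \<open>a + c\<close> add up to the mixed sum
    \<open>a + b\<close>. The main term agrees with that of \<open>N6\<close>; only the penalties
    differ.\<close>
  have N5: "k \<le> (8 * h12 + 2 * (h11 + h22) - 3 * s - 3 * T) + \<eta> * (k + k)"
  proof (rule minD)
    let ?C = "\<lambda>w. (b w + c w + (a w + c w), ?S w)"
    have C: "H p ?C = 2 * h12"
    proof -
      have "?C = (\<lambda>w. (a w + b w, ?S w))" by (rule ext) (simp add: ac_simps)
      then show ?thesis using US by simp
    qed
    have T: "H p (\<lambda>w. (b w + c w, a w + c w, ?S w)) = T"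
      unfolding T_def
      by (rule H_eqI[where f="\<lambda>(x, y, z). (x + y, x, z)" and g="\<lambda>(x, y, z). (y, x + y, z)"])
          (auto simp: ac_simps)
    show "k \<le> (8 * h12 + 2 * (h11 + h22) - 3 * s - 3 * T)
       + \<eta> * (cdist x0 p (\<lambda>w. b w + c w) ?C - rdist x0 x1) + \<eta> *
           (cdist y0 p (\<lambda>w. a w + c w) ?C - rdist y0 x2)"
      using rdist_minimal_BSG[OF min', where p=p and A="\<lambda>w. b w + c w" and S="?S"
          and B="\<lambda>w. a w + c w"]
      unfolding C T VS WS s_def[symmetric] by simp
    \<comment> \<open>The shift \<open>h = snd\<close> by the total sum turns \<open>a + d\<close>
      into \<open>b + c\<close>; for the other penalty, \<open>h = fst\<close> shifts
      \<open>b + c\<close> by \<open>a + b\<close> into \<open>a + c\<close>.\<close>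
    have "cdist x0 p (\<lambda>w. a w + d w) (\<lambda>w. (a w + b w, a w + d w + b w + c w)) = cdist x0 p
        (\<lambda>w. b w + c w) ?C"
      by (rule cdist_cong[where f="\<lambda>x. x" and g="\<lambda>x. x" and h=snd]) (simp_all add: ac_simps)
    then show "cdist x0 p (\<lambda>w. b w + c w) ?C \<le> rdist x0 x1 + k"
      using cdist_sum_given_sum_le[OF indep_adbc, of x0] by (simp add: HS k field_simps)
    have "cdist y0 p (\<lambda>w. b w + c w) (\<lambda>w. (b w + a w, b w + c w + a w + d w)) = cdist y0 p
        (\<lambda>w. a w + c w) ?C"
      by (rule cdist_cong[where f="\<lambda>x. x" and g="\<lambda>x. x" and h=fst]) (simp_all add: ac_simps)
    moreover have "H p (\<lambda>w. b w + a w) = h12" using sums(1) by (simp add: add.commute hs)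
    ultimately show "cdist y0 p (\<lambda>w. a w + c w) ?C \<le> rdist y0 x2 + k"
      using cdist_sum_given_sum_le[OF indep_bcad, of y0] by (simp add: HS k field_simps)
  qed
  \<comment> \<open>Now \<open>a + b\<close> and \<open>b + c\<close> add up to
    \<open>a + c\<close>, so \<open>h11\<close> and \<open>h22\<close> enter the penalties.\<close>
  have N6: "k \<le> (8 * h12 + 2 * (h11 + h22) - 3 * s - 3 * T)
     + \<eta> * ((h12 + h11 - 2 * h1) / 2 + (h12 + h22 - 2 * h2) / 2)"
  proof (rule minD)
    let ?C = "\<lambda>w. (a w + b w + (b w + c w), ?S w)"
    have C: "H p ?C = h11 + h22"
    proof -
      have "?C = (\<lambda>w. (a w + c w, ?S w))" by (rule ext) (simp add: ac_simps)
      then show ?thesis using WS by simp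
    qed
    show "k \<le> (8 * h12 + 2 * (h11 + h22) - 3 * s - 3 * T)
       + \<eta> * (cdist x0 p (\<lambda>w. a w + b w) ?C - rdist x0 x1) + \<eta> *
           (cdist y0 p (\<lambda>w. b w + c w) ?C - rdist y0 x2)"
      using rdist_minimal_BSG[OF min', where p=p and A="\<lambda>w. a w + b w" and S="?S"
          and B="\<lambda>w. b w + c w"]
      unfolding C US VS s_def[symmetric] T_def[symmetric] by simp
    have "cdist x0 p (\<lambda>w. a w + b w) (\<lambda>w. (a w + c w, a w + b w + c w + d w)) = cdist x0 p
        (\<lambda>w. a w + b w) ?C"
      by (rule cdist_cong[where f="\<lambda>x. x" and g="\<lambda>x. x" and h="\<lambda>_. 0"]) (simp_all add: ac_simps)
    then show "cdist x0 p (\<lambda>w. a w + b w) ?C \<le> rdist x0 x1 + (h12 + h11 - 2 * h1) / 2"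
      using cdist_sum_given_sum_le[OF indep, of x0] by (simp add: HS)
    have "cdist y0 p (\<lambda>w. b w + c w) (\<lambda>w. (b w + d w, b w + c w + d w + a w)) = cdist y0 p
        (\<lambda>w. b w + c w) ?C"
      by (rule cdist_cong[where f="\<lambda>(x, y). (x + y, y)" and g="\<lambda>(x, y). (x + y, y)" and h="\<lambda>_. 0"])
          (simp_all add: ac_simps)
    then show "cdist y0 p (\<lambda>w. b w + c w) ?C \<le> rdist y0 x2 + (h12 + h22 - 2 * h2) / 2"
      using cdist_sum_given_sum_le[OF indep_bcda, of y0] by (simp add: HS)
  qed
  have "k = 0"
  proof (rule minimal_distance_arith[OF \<eta>, of k "s - (h1 + h2) / 2" "T - 3 * (h1 + h2) / 2" D])
    show "0 \<le> k" by (simp add: k_def rdist_nonneg)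
    show "k \<le> s - (h1 + h2) / 2 - k + \<eta> * k"
      using N1 unfolding D_def k by (simp add: field_simps)
    show "k \<le> T - 3 * (h1 + h2) / 2 - k + \<eta> * k"
      using N2 unfolding D_def k by (simp add: field_simps)
    show "k \<le> s - (h1 + h2) / 2 - D / 2 + \<eta> * D / 2"
      using N3 unfolding D_def k by (simp add: field_simps)
    show "k \<le> T - 3 * (h1 + h2) / 2 - D / 2 + \<eta> * D / 2"
      using N4 unfolding D_def k by (simp add: field_simps)
    show "k \<le> 8 * k + 2 * D - 3 * (s - (h1 + h2) / 2 + (T - 3 * (h1 + h2) / 2)) + 2 * \<eta> * k"
      using N5 unfolding D_def k by (simp add: field_simps)
    show "k \<le> 8 * k + 2 * D - 3 * (s - (h1 + h2) / 2 + (T - 3 * (h1 + h2) / 2)) + \<eta> * (k + D / 2)"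
      using N6 unfolding D_def k by (simp add: field_simps)
  qed
  then show ?thesis by (simp add: k_def)
qed

subsection \<open>Laws of self-distance zero\<close>

lemma conv_assoc: "conv (conv x y) z = conv x (conv y (z :: 'a::semigroup_add pmf))"
  by (simp add: conv_def pair_pmf_def map_pmf_def bind_assoc_pmf bind_return_pmf add.assoc)

text \<open>\<open>rdist_add_le\<close> bounds the distance from \<open>x\<close> to
  \<open>conv y z\<close>, and dropping \<open>y\<close> from the triple sum does not raise the
  entropy.\<close>

lemma rdist_triangle: "rdist x z \<le> rdist x y + rdist y z"
proof -
  have "rdist x (map_pmf (\<lambda>w. fst w + snd w) (pair_pmf y z))
      \<le> rdist x (map_pmf fst (pair_pmf y z))
          + (H (pair_pmf y z) (\<lambda>w. fst w + snd w) - H (pair_pmf y z) fst) / 2"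
    by (rule rdist_add_le) (simp add: ent_pair map_fst_pair_pmf map_snd_pair_pmf)
  then have "rdist x (conv y z) \<le> rdist x y + (ent (conv y z) - ent y) / 2"
    by (simp add: conv_def split_def map_fst_pair_pmf)
  moreover have "ent (conv x z) \<le> ent (conv x (conv y z))"
  proof -
    have "conv x (conv y z) = conv (conv x z) y"
      by (simp add: conv_commute[of y z] conv_assoc)
    then show ?thesis using ent_conv_ge[of "conv x z" y] by simp
  qed
  ultimately show ?thesis by (simp add: rdist_def field_simps)
qed

lemma rdist_translate: "rdist y (map_pmf (\<lambda>v. v + a) x) = rdist y x"
proof -
  have "H (pair_pmf y x) (\<lambda>(u, w). u + (w + a)) = H (pair_pmf y x) (\<lambda>(u, w). u + w)"
      "H x (\<lambda>v. v + a) = H x (\<lambda>v. v)"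
    by (rule H_cong; auto simp flip: add.assoc)+
  then show ?thesis by (simp add: rdist_map) (simp add: rdist_def conv_def)
qed

text \<open>Equality case of Gibbs against the product of the marginals.\<close>

lemma H_indep_pmf:
  fixes p :: "'w::finite pmf" and X :: "'w \<Rightarrow> 'a::finite" and Y :: "'w \<Rightarrow> 'b::finite"
  assumes "H p (\<lambda>w. (X w, Y w)) = H p X + H p Y"
  shows "pmf (map_pmf (\<lambda>w. (X w, Y w)) p) (x, y) = pmf (map_pmf X p) x * pmf (map_pmf Y p) y"
proof -
  define P where "P = map_pmf (\<lambda>w. (X w, Y w)) p"
  define q where "q t = pmf (map_pmf fst P) (fst t) * pmf (map_pmf snd P) (snd t)" for t
  have XY: "map_pmf X p = map_pmf fst P" "map_pmf Y p = map_pmf snd P"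
    by (simp_all add: P_def map_pmf_comp)
  have pos: "pmf (map_pmf fst P) (fst t) > 0 \<and> pmf (map_pmf snd P) (snd t) > 0" if
      "t \<in> set_pmf P" for t
    using that by (auto simp: pmf_positive_iff)
  have "(\<Sum>t\<in>UNIV. q t) = (\<Sum>x\<in>UNIV. \<Sum>y\<in>UNIV. pmf (map_pmf fst P) x * pmf (map_pmf snd P) y)"
    by (auto simp: q_def sum.cartesian_product intro!: sum.cong)
  then have q1: "(\<Sum>t\<in>UNIV. q t) = 1" by (simp add: sum_product[symmetric])
  have "(\<Sum>t\<in>UNIV. pmf P t * - log 2 (q t))
     = (\<Sum>t\<in>UNIV. pmf P t * - log 2 (pmf (map_pmf fst P) (fst t)) + pmf P t * - log 2
         (pmf (map_pmf snd P) (snd t)))"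
  proof (intro sum.cong refl)
    fix t
    show "pmf P t * - log 2 (q t) = pmf P t * - log 2
        (pmf (map_pmf fst P) (fst t)) + pmf P t * - log 2 (pmf (map_pmf snd P) (snd t))"
    proof (cases "t \<in> set_pmf P")
      case True
      have "log 2 (q t) = log 2 (pmf (map_pmf fst P) (fst t)) + log 2 (pmf (map_pmf snd P) (snd t))"
        using pos[OF True] by (simp add: q_def log_mult)
      then show ?thesis by (simp only:) (simp add: algebra_simps)
    qed (simp add: set_pmf_iff)
  qed
  also have "\<dots> = ent P"
    using assms unfolding P_def[symmetric] XY by (simp only: sum.distrib H_eq)
  finally have e: "ent P = (\<Sum>t\<in>UNIV. pmf P t * - log 2 (q t))" by simp
  have "pmf P (x, y) = q (x, y)"
    by (rule gibbs(2)[OF _ _ _ e]) (auto simp: q_def q1[unfolded q_def] dest!: pos)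
  then show ?thesis by (simp add: P_def[symmetric] XY q_def)
qed

text \<open>Distance zero makes the sum of two independent copies independent of the second copy.
  Hence all translates of \<open>x\<close> by points of its support coincide, and \<open>x\<close>
  is uniform on a coset of its group of periods \<open>V\<close>.\<close>

lemma rdist_self_eq_zero_imp_uniform:
  fixes x :: "'a::char2_group pmf"
  assumes "rdist x x = 0"
  obtains V a where "0 \<in> V" "\<And>u v. u \<in> V \<Longrightarrow> v \<in> V \<Longrightarrow> u + v \<in> V" "map_pmf (\<lambda>v. v + a) x = pmf_of_set V"
proof -
  let ?p = "pair_pmf x x"
  have "H ?p (\<lambda>w. (fst w + snd w, snd w)) = H ?p (\<lambda>w. w)"
    by (rule H_cong) (auto simp: prod_eq_iff)
  moreover have c: "map_pmf (\<lambda>w. fst w + snd w) ?p = conv x x" "map_pmf snd ?p = x"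
    by (simp_all add: conv_def split_def map_snd_pair_pmf)
  ultimately have "H ?p (\<lambda>w. (fst w + snd w, snd w)) = H ?p (\<lambda>w. fst w + snd w) + H ?p snd"
    using assms by (simp add: ent_pair rdist_def)
  from H_indep_pmf[OF this]
  have 1: "pmf (map_pmf (\<lambda>w. (fst w + snd w, snd w)) ?p) (s, b) = pmf (conv x x) s * pmf x b" for s
      b
    by (simp add: c)
  have inj: "inj (\<lambda>w::'a \<times> 'a. (fst w + snd w, snd w))" by (auto simp: inj_def prod_eq_iff)
  \<comment> \<open>Cancels the positive factor \<open>pmf x b\<close> from
    \<open>1\<close>.\<close>
  have 2: "pmf x (s + b) = pmf (conv x x) s" if "b \<in> set_pmf x" for s b
    using pmf_map_inj'[OF inj, of ?p "(s + b, b)"] 1[of s b] that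
    by (simp add: pmf_pair add.assoc set_pmf_iff)
  define V where "V = {v. \<forall>u. pmf x (u + v) = pmf x u}"
  obtain a where a: "a \<in> set_pmf x" using set_pmf_not_empty[of x] by blast
  have 0: "0 \<in> V" by (simp add: V_def)
  have add: "u + v \<in> V" if "u \<in> V" "v \<in> V" for u v
    using that by (simp add: V_def flip: add.assoc)
  have val: "pmf x (v + a) = (if v \<in> V then pmf x a else 0)" for v
  proof (cases "v \<in> V")
    case True
    then show ?thesis by (simp add: V_def add.commute)
  next
    case False
    \<comment> \<open>If both \<open>a\<close> and \<open>v + a\<close> are support points, their
      difference \<open>v\<close> is a period.\<close>
    have "v + a \<notin> set_pmf x"
    proof
      assume va: "v + a \<in> set_pmf x"
      have "pmf x (u + v) = pmf x u" for u
        using 2[OF va, of "u + a"] 2[OF a, of "u + a"] by (simp add: ac_simps)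
      then show False using False by (simp add: V_def)
    qed
    then show ?thesis using False by (simp add: set_pmf_iff)
  qed
  have tr: "pmf (map_pmf (\<lambda>v. v + a) x) v = pmf x (v + a)" for v
    using pmf_map_inj'[of "\<lambda>v. v + a" x "v + a"] by (simp add: inj_def add.assoc)
  have "1 = (\<Sum>v\<in>UNIV. pmf (map_pmf (\<lambda>v. v + a) x) v)" by simp
  also have "\<dots> = (\<Sum>v\<in>V. pmf x a)"
    unfolding tr val by (simp add: sum.If_cases)
  finally have "pmf x a = 1 / card V"
    using 0 by (auto simp: eq_divide_eq mult.commute)
  then have "map_pmf (\<lambda>v. v + a) x = pmf_of_set V"
    using 0 by (intro pmf_eqI) (subst pmf_of_set, auto simp: tr val)
  with 0 add show ?thesis by (rule that)
qed

lemma pmf_conv: "pmf (conv x y) z = (\<Sum>u\<in>UNIV. pmf x u * pmf y (u + (z :: 'a::char2_group)))"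
proof -
  have "pmf (conv x y) z = (\<Sum>t\<in>{t. fst t + snd t = z}. pmf (pair_pmf x y) t)"
    unfolding conv_def pmf_map by (subst measure_measure_pmf_finite)
        (auto simp: vimage_def split_def)
  also have "\<dots> = (\<Sum>u\<in>UNIV. pmf (pair_pmf x y) (u, u + z))"
    by (rule sum.reindex_bij_witness[where i="\<lambda>u. (u, u + z)" and j=fst]) auto
  finally show ?thesis by (simp add: pmf_pair)
qed

subsection \<open>Existence of minimizers\<close>

text \<open>Continuity is needed up to the boundary of the simplex; the value at 0 is 0, matching
  the one-sided limit.\<close>

lemma continuous_on_xlogx: "continuous_on {0..} (\<lambda>t::real. - t * log 2 t)"
  unfolding continuous_on_eq_continuous_within
proof
  fix t :: real assume t: "t \<in> {0..}"
  show "continuous (at t within {0..}) (\<lambda>t. - t * log 2 t)"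
  proof (cases "t = 0")
    case True
    have "((\<lambda>t::real. - t * log 2 t) \<longlongrightarrow> 0) (at_right 0)" by real_asymp
    then show ?thesis unfolding True continuous_within at_within_Ici_at_right by simp
  next
    case False
    then show ?thesis using t by (intro continuous_intros) auto
  qed
qed

text \<open>Laws are the points of the probability simplex \<open>K\<close>, which is compact, and
  the functional is continuous on \<open>K \<times> K\<close>.\<close>

lemma exists_minimizer:
  fixes x0 y0 :: "'a::char2_group pmf"
  obtains x1 x2 where "\<And>x y. rdist x1 x2 + \<eta> * rdist x0 x1 + \<eta> * rdist y0 x2
      \<le> rdist x y + \<eta> * rdist x0 x + \<eta> * rdist y0 y"
proof -
  define K where "K = {f :: (real, 'a) vec. (\<forall>i. 0 \<le> f $ i) \<and> (\<Sum>i\<in>UNIV. f $ i) = 1}"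
  define vc where "vc x = (\<chi> i. pmf x i)" for x :: "'a pmf"
  have vcK: "vc x \<in> K" for x by (simp add: vc_def K_def)
  have K_vc: "\<exists>x. f = vc x" if "f \<in> K" for f
  proof -
    have "(\<integral>\<^sup>+ i. ennreal (f $ i) \<partial>count_space UNIV) = 1"
      using that by (simp add: K_def nn_integral_count_space_finite)
    then have "pmf (embed_pmf (($) f)) i = f $ i" for i
      using that by (intro pmf_embed_pmf) (auto simp: K_def)
    then have "f = vc (embed_pmf (($) f))" by (simp add: vc_def vec_eq_iff)
    then show ?thesis ..
  qed
  have "compact K"
    unfolding compact_eq_bounded_closed
  proof
    have "norm f \<le> 1" if "f \<in> K" for f
      using norm_le_l1_cart[of f] that by (simp add: K_def)
    then show "bounded K" by (auto simp: bounded_iff)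
    have "K = (\<Inter>i. {f. 0 \<le> f $ i}) \<inter> {f. (\<Sum>i\<in>UNIV. f $ i) = 1}" by (auto simp: K_def)
    also have "closed \<dots>"
      by (intro closed_Int closed_INT ballI closed_Collect_le closed_Collect_eq continuous_intros)
    finally show "closed K" .
  qed
  define E where "E f = (\<Sum>i\<in>UNIV. - (f $ i) * log 2 (f $ i))" for f :: "(real, 'a) vec"
  \<comment> \<open>\<open>C\<close> and \<open>R\<close> extend \<open>conv\<close> and
    \<open>rdist\<close> to all vectors by their coordinate formulas.\<close>
  define C where "C f g = (\<chi> z. \<Sum>u\<in>UNIV. f $ u * g $ (u + z))" for f g :: "(real, 'a) vec"
  define R where "R f g = E (C f g) - (E f + E g) / 2" for f g
  have R: "rdist x y = R (vc x) (vc y)" for x y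
    by (simp add: rdist_def R_def E_def C_def vc_def ent_def pmf_conv)
  have contE: "continuous_on S (\<lambda>s. E (F s))"
    if "continuous_on S F" "\<And>s i. s \<in> S \<Longrightarrow> 0 \<le> F s $ i" for F ::
        "(real, 'a) vec \<times> (real, 'a) vec \<Rightarrow> (real, 'a) vec" and S
    unfolding E_def
    by (intro continuous_on_sum continuous_on_compose2[OF continuous_on_xlogx]
        continuous_on_component that(1))
       (auto simp: that(2))
  have contR: "continuous_on S (\<lambda>s. R (F s) (G s))"
    if "continuous_on S F" "continuous_on S G" "\<And>s i. s \<in> S \<Longrightarrow> 0 \<le> F s $ i"
        "\<And>s i. s \<in> S \<Longrightarrow> 0 \<le> G s $ i"
    for F G :: "(real, 'a) vec \<times> (real, 'a) vec \<Rightarrow> (real, 'a) vec" and S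
    unfolding R_def C_def
    by (intro continuous_on_diff continuous_on_divide continuous_on_add contE
        continuous_on_vec_lambda
         continuous_on_sum continuous_on_mult continuous_on_component continuous_on_const that)
       (auto intro!: sum_nonneg mult_nonneg_nonneg that(3,4))
  have vcpos: "0 \<le> vc x $ i" for x i by (simp add: vc_def)
  define G where "G s = R (fst s) (snd s) + \<eta> * R (vc x0) (fst s) + \<eta> * R (vc y0) (snd s)" for s
  have "continuous_on (K \<times> K) G"
    unfolding G_def
    by (intro continuous_on_add continuous_on_mult contR continuous_on_const continuous_on_fst
        continuous_on_snd continuous_on_id)
       (auto simp: vcpos K_def)
  moreover have "compact (K \<times> K)" "K \<times> K \<noteq> {}" using \<open>compact K\<close> vcK by (auto intro: compact_Times)
  ultimately obtain t where t: "t \<in> K \<times> K" "\<And>s. s \<in> K \<times> K \<Longrightarrow> G t \<le> G s"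
    using continuous_attains_inf[of "K \<times> K" G] by blast
  then obtain x1 x2 where t': "t = (vc x1, vc x2)" using K_vc by (cases t) blast
  have "rdist x1 x2 + \<eta> * rdist x0 x1 + \<eta> * rdist y0 x2
      \<le> rdist x y + \<eta> * rdist x0 x + \<eta> * rdist y0 y" for x y
    using t(2)[of "(vc x, vc y)"] vcK by (simp add: G_def t' R)
  then show ?thesis by (rule that)
qed

section \<open>From minimizers to a subgroup\<close>

text \<open>Distance zero makes \<open>x1\<close> a translate of a uniform law and, by the triangle
  inequality, lets \<open>x1\<close> replace \<open>x2\<close> in the second penalty.\<close>

lemma entropic_PFR_eta:
  fixes x0 y0 :: "'a::char2_group pmf"
  assumes \<eta>: "0 < \<eta>" "\<eta> < 1 / 8"
  shows "\<exists>V. 0 \<in> V \<and> (\<forall>u\<in>V. \<forall>v\<in>V. u + v \<in> V) \<and>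
    rdist x0 (pmf_of_set V) + rdist y0 (pmf_of_set V) \<le> (2 + 1 / \<eta>) * rdist x0 y0"
proof -
  obtain x1 x2 where min: "\<And>x y. rdist x1 x2 + \<eta> * rdist x0 x1 + \<eta> * rdist y0 x2
      \<le> rdist x y + \<eta> * rdist x0 x + \<eta> * rdist y0 y"
    using exists_minimizer[of \<eta> x0 y0] by blast
  have zero: "rdist x1 x2 = 0"
  proof (rule minimal_distance_zero[OF \<eta>])
    show "rdist x1 x2 \<le> rdist x y + \<eta> * (rdist x0 x - rdist x0 x1) + \<eta> * (rdist y0 y - rdist y0 x2)"
        for x y
      using min[of x y] by (simp add: algebra_simps)
  qed
  have "rdist x1 x1 = 0"
    using rdist_triangle[of x1 x1 x2] rdist_nonneg[of x1 x1] zero by (simp add: rdist_commute)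
  then obtain V a where V: "0 \<in> V" "\<And>u v. u \<in> V \<Longrightarrow> v \<in> V \<Longrightarrow> u + v \<in> V"
      "map_pmf (\<lambda>v. v + a) x1 = pmf_of_set V"
    by (rule rdist_self_eq_zero_imp_uniform) blast
  have "rdist y0 x1 \<le> rdist y0 x2" using rdist_triangle[of y0 x1 x2] zero by
      (simp add: rdist_commute)
  moreover have "rdist x0 (pmf_of_set V) = rdist x0 x1" "rdist y0 (pmf_of_set V) = rdist y0 x1"
    unfolding V(3)[symmetric] by (rule rdist_translate)+
  ultimately have "\<eta> * (rdist x0 (pmf_of_set V) + rdist y0 (pmf_of_set V)) \<le> \<eta> *
      (rdist x0 x1 + rdist y0 x2)"
    using \<eta> by (intro mult_left_mono) auto
  \<comment> \<open>The test pair is swapped so that both penalties are \<open>rdist x0 y0\<close>;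
    unswapped, they would be self-distances.\<close>
  also have "\<dots> \<le> (1 + 2 * \<eta>) * rdist x0 y0"
    using min[of y0 x0] zero by (simp add: rdist_commute[of y0 x0] algebra_simps)
  finally have "rdist x0 (pmf_of_set V) + rdist y0 (pmf_of_set V) \<le> (2 + 1 / \<eta>) * rdist x0 y0"
    using \<eta> by (simp add: field_simps)
  with V(1,2) show ?thesis by blast
qed

text \<open>The best subgroup among the finitely many does not depend on \<open>\<eta>\<close>, so
  its bound survives the limit \<open>\<eta>\<close> to 1/8, where \<open>2 + 1 / \<eta>\<close>
  becomes 10.\<close>

lemma entropic_PFR:
  fixes x0 y0 :: "'a::char2_group pmf"
  shows "\<exists>V. 0 \<in> V \<and> (\<forall>u\<in>V. \<forall>v\<in>V. u + v \<in> V) \<and>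
    rdist x0 (pmf_of_set V) + rdist y0 (pmf_of_set V) \<le> 10 * rdist x0 y0"
proof -
  define F where "F V = rdist x0 (pmf_of_set V) + rdist y0 (pmf_of_set V)" for V
  define W where "W = {V :: 'a set. 0 \<in> V \<and> (\<forall>u\<in>V. \<forall>v\<in>V. u + v \<in> V)}"
  have "finite W" "UNIV \<in> W" by (auto simp: W_def)
  then obtain V where V: "V \<in> W" "\<And>U. U \<in> W \<Longrightarrow> F V \<le> F U"
    using arg_min_if_finite[of W F] by (metis empty_iff not_le)
  have "F V \<le> 10 * rdist x0 y0 + e" if "e > 0" for e
  proof -
    \<comment> \<open>With \<open>\<eta> = 1 / (8 + d)\<close> the constant is
      \<open>10 + d\<close>; the added 1 keeps the denominator positive at distance zero.\<close>
    define d where "d = e / (rdist x0 y0 + 1)"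
    have d: "d > 0" using that rdist_nonneg[of x0 y0] by (simp add: d_def)
    then obtain U where "U \<in> W" "F U \<le> (2 + 1 / (1 / (8 + d))) * rdist x0 y0"
      using entropic_PFR_eta[of "1 / (8 + d)" x0 y0] by (auto simp: W_def F_def field_simps)
    then have "F V \<le> (10 + d) * rdist x0 y0" using V(2)[of U] by simp
    moreover have "d * rdist x0 y0 \<le> e"
      using that rdist_nonneg[of x0 y0] by (simp add: d_def field_simps)
    ultimately show ?thesis by (simp add: algebra_simps)
  qed
  then have "F V \<le> 10 * rdist x0 y0" by (rule field_le_epsilon)
  then show ?thesis using V(1) by (auto simp: F_def W_def)
qed

subsection \<open>Random variables\<close>

definition law :: "'w measure \<Rightarrow> ('w \<Rightarrow> 'a::finite) \<Rightarrow> 'a pmf" where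
  "law M X = embed_pmf (\<lambda>x. measure M (X -` {x} \<inter> space M))"

lemma pmf_law:
  assumes "prob_space M" and X: "X \<in> measurable M (count_space UNIV)"
  shows "pmf (law M X) x = measure M (X -` {x} \<inter> space M)"
proof -
  interpret prob_space M by fact
  have "(\<Sum>x\<in>UNIV. measure M (X -` {x} \<inter> space M)) = measure M (\<Union>x. X -` {x} \<inter> space M)"
    using X by (subst finite_measure_finite_Union) (auto simp: disjoint_family_on_def)
  also have "(\<Union>x. X -` {x} \<inter> space M) = space M" by auto
  finally have "(\<Sum>x\<in>UNIV. measure M (X -` {x} \<inter> space M)) = 1" by (simp add: prob_space)
  then show ?thesis
    unfolding law_def by (intro pmf_embed_pmf) (auto simp: nn_integral_count_space_finite)
qed

lemma shannon_entropy_law: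
  assumes "prob_space M" "X \<in> measurable M (count_space UNIV)"
  shows "shannon_entropy M X = ent (law M X)"
  unfolding shannon_entropy_eq_sum[OF assms] ent_def pmf_law[OF assms]
  by (rule sum.mono_neutral_left) auto

text \<open>Each event that the difference equals \<open>z\<close> is a disjoint union of rectangles
  \<open>?R z a\<close> over the values \<open>a\<close> of \<open>X\<close>, on which the product
  measure factors as in \<open>pmf_conv\<close>.\<close>

lemma ruzsa_dist_law:
  fixes X :: "'w \<Rightarrow> 'a::char2_group"
  assumes M: "prob_space M" and X: "X \<in> measurable M (count_space UNIV)"
    and N: "prob_space N" and Y: "Y \<in> measurable N (count_space UNIV)"
  shows "ruzsa_dist M X N Y = rdist (law M X) (law N Y)"
proof -
  interpret M: prob_space M by fact
  interpret N: prob_space N by fact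
  interpret pair_prob_space M N ..
  let ?Z = "\<lambda>(w, v). X w - Y v"
  let ?R = "\<lambda>z a. (X -` {a} \<inter> space M) \<times> (Y -` {a + z} \<inter> space N)"
  have R: "?R z a \<in> sets (M \<Otimes>\<^sub>M N)" for z a
    using X Y by (intro pair_measureI) auto
  have mR: "measure (M \<Otimes>\<^sub>M N) (?R z a) = pmf (law M X) a * pmf (law N Y) (a + z)" for z a
    using X Y by (simp add: measure_def N.emeasure_pair_measure_Times enn2real_mult pmf_law M N)
  have "a + b = z \<longleftrightarrow> b = a + z" for a b z :: 'a by auto
  then have pre: "?Z -` {z} \<inter> space (M \<Otimes>\<^sub>M N) = (\<Union>a. ?R z a)" for z
    by (auto simp: space_pair_measure)
  have Z: "?Z \<in> measurable (M \<Otimes>\<^sub>M N) (count_space UNIV)"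
    by (subst measurable_count_space_eq2) (use R in \<open>auto simp: pre simp del: diff_eq_add\<close>)
  have "law (M \<Otimes>\<^sub>M N) ?Z = conv (law M X) (law N Y)"
  proof (rule pmf_eqI)
    fix z
    have "pmf (law (M \<Otimes>\<^sub>M N) ?Z) z = measure (M \<Otimes>\<^sub>M N) (\<Union>a. ?R z a)"
      using pmf_law[OF P.prob_space_axioms Z] by (simp only: pre)
    also have "\<dots> = (\<Sum>a\<in>UNIV. measure (M \<Otimes>\<^sub>M N) (?R z a))"
      using R by (subst P.finite_measure_finite_Union) (auto simp: disjoint_family_on_def)
    finally show "pmf (law (M \<Otimes>\<^sub>M N) ?Z) z = pmf (conv (law M X) (law N Y)) z"
      by (simp only: mR pmf_conv)
  qed
  then show ?thesis
    using shannon_entropy_law[OF P.prob_space_axioms Z] shannon_entropy_law[OF M X]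
        shannon_entropy_law[OF N Y]
    by (simp add: ruzsa_dist_def rdist_def)
qed

lemma law_uniform_count_measure:
  fixes V :: "'a::finite set"
  assumes "V \<noteq> {}"
  shows "law (uniform_count_measure V) (\<lambda>v. v) = pmf_of_set V"
proof (rule pmf_eqI)
  fix x
  have "measure (uniform_count_measure V) ({x} \<inter> V) = card ({x} \<inter> V) / card V"
    by (rule measure_uniform_count_measure) auto
  then show "pmf (law (uniform_count_measure V) (\<lambda>v. v)) x = pmf (pmf_of_set V) x"
    using assms by (subst pmf_law) (auto intro: prob_space_uniform_count_measure simp: indicator_def
        space_uniform_count_measure
      sets_uniform_count_measure measurable_def vimage_def)
qed

theorem theorem1p4:
  fixes M :: "'w measure" and N :: "'v measure"
    and A :: "'w \<Rightarrow> bit ^ 'n" and B :: "'v \<Rightarrow> bit ^ 'n"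
  assumes "prob_space M" and "A \<in> measurable M (count_space UNIV)"
    and "prob_space N" and "B \<in> measurable N (count_space UNIV)"
  shows "\<exists>V :: (bit ^ 'n) set. vec.subspace V \<and>
    ruzsa_dist M A (uniform_count_measure V) (\<lambda>v. v)
      + ruzsa_dist N B (uniform_count_measure V) (\<lambda>v. v)
      \<le> 10 * ruzsa_dist M A N B"
proof -
  obtain V where V: "0 \<in> V" "\<forall>u\<in>V. \<forall>v\<in>V. u + v \<in> V"
    "rdist (law M A) (pmf_of_set V) + rdist (law N B) (pmf_of_set V) \<le> 10 * rdist (law M A)
        (law N B)"
    using entropic_PFR[of "law M A" "law N B"] by blast
  \<comment> \<open>The only scalars are 0 and 1, so an additive subgroup is a subspace.\<close>
  have "c *s v \<in> V" if "v \<in> V" for c v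
    using that V(1) by (cases c) auto
  then have sub: "vec.subspace V"
    using V by (auto simp: vec.subspace_def)
  have U: "prob_space (uniform_count_measure V)"
      "(\<lambda>v. v) \<in> measurable (uniform_count_measure V) (count_space UNIV)"
    using V(1) by (auto intro: prob_space_uniform_count_measure simp: measurable_def
        space_uniform_count_measure sets_uniform_count_measure)
  have L: "law (uniform_count_measure V) (\<lambda>v. v) = pmf_of_set V"
    using V(1) by (intro law_uniform_count_measure) auto
  have "ruzsa_dist M A (uniform_count_measure V) (\<lambda>v. v)
      + ruzsa_dist N B (uniform_count_measure V) (\<lambda>v. v) \<le> 10 * ruzsa_dist M A N B"
    using V(3)
    unfolding ruzsa_dist_law[OF assms] ruzsa_dist_law[OF assms(1,2) U]
        ruzsa_dist_law[OF assms(3,4) U] L .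
  with sub show ?thesis by blast
qed

end
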